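(* Let $\mathcal{C}$ be a cocomplete locally small category, $\mathcal{J}$ a small category and $U:\mathcal{J}\to\mathcal{C}^{\mathbf 2}$ a functor. For every $f\in\mathcal{C}^{\mathbf 2}$ there is an isomorphism (bijection) $$\kappa_{f,g}:\mathcal{C}^{\mathbf 2}(Tf,g)\;\cong\;\mathcal{J}\text{-}1\text{-}\mathrm{Step}(f,g)$$ natural in $g\in\mathcal{C}^{\mathbf 2}$.
   Context: $\mathcal{C}^{\mathbf 2}$ is the category of arrows of $\mathcal{C}$; a morphism $\sigma:f\to g$ is a commutative square $\sigma=(\sigma_0,\sigma_1)$, with $\sigma_0$ between domains and $\sigma_1$ between codomains. For $j\in\mathcal{J}$ write $Uj:A_j\to B_j$. **Construction of $Tf$.** Let $f:X\to Y$ in $\mathcal{C}$. The comma category $U\downarrow f$ has objects pairs $(j,\sigma)$ with $j\in\mathcal{J}$ and $\sigma:Uj\to f$ in $\mathcal{C}^{\mathbf 2}$, and morphisms $(i,\tau)\to(j,\sigma)$ the morphisms $\alpha:i\to j$ of $\mathcal{J}$ with $\sigma\circ U\alpha=\tau$. Let $Cf:A\to B$ be the colimit in $\mathcal{C}^{\mathbf 2}$ of the composite $U\downarrow f\to\mathcal{J}\xrightarrow{U}\mathcal{C}^{\mathbf 2}$, and let $\varepsilon_f:Cf\to f$ be the morphism induced by the cocone $(\sigma:Uj\to f)_{(j,\sigma)}$. Let $Sf$ be the pushout of $Cf:A\to B$ along $(\varepsilon_f)_0:A\to X$, with coprojections $Kf:X\to Sf$ and $q_f:B\to Sf$; and let $Tf:Sf\to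 Y$ be the unique map with $Tf\circ Kf=f$ and $Tf\circ q_f=(\varepsilon_f)_1$. **One-step lifting structures.** For $f:X\to Y$ and $g:C\to D$, a one-step lifting structure from $f$ to $g$ is a pair $(u,\phi)$ where $u:f\to g$ is a morphism of $\mathcal{C}^{\mathbf 2}$ and $\phi$ assigns to each $j\in\mathcal{J}$ and each $\sigma:Uj\to f$ a morphism $\phi_j(\sigma):B_j\to C$ with $\phi_j(\sigma)\circ Uj=u_0\circ\sigma_0$ and $g\circ\phi_j(\sigma)=u_1\circ\sigma_1$, such that for every $\alpha:i\to j$ in $\mathcal{J}$ one has $\phi_i(\sigma\circ U\alpha)=\phi_j(\sigma)\circ(U\alpha)_1$. The set of these is $\mathcal{J}\text{-}1\text{-}\mathrm{Step}(f,g)$. It is functorial in $g$: a morphism $b:g\to g'$ sends $(u,\phi)$ to $(b\circ u,\ b_0\circ\phi_j(-))$. *)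

theory Defs
  imports Main "HOL-Library.FuncSet"
begin

unbundle cardinal_syntax

text \<open>Categories are given by explicit carriers of objects and arrows; all laws are relative to
  them. Composition is written in the usual order: \<open>g \<cdot>\<^bsub>C\<^esub> f\<close> is \<open>g\<close> after \<open>f\<close>.\<close>

record ('o, 'm) cat =
  Obj :: "'o set"
  Arr :: "'m set"
  Dom :: "'m \<Rightarrow> 'o"
  Cod :: "'m \<Rightarrow> 'o"
  Id :: "'o \<Rightarrow> 'm"
  Comp :: "'m \<Rightarrow> 'm \<Rightarrow> 'm"  (infixl "\<cdot>\<index>" 70)

definition hom :: "('o, 'm) cat \<Rightarrow> 'o \<Rightarrow> 'o \<Rightarrow> 'm set" where
  "hom C a b = {f \<in> Arr C. Dom C f = a \<and> Cod C f = b}"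

locale category =
  fixes C :: "('o, 'm) cat" (structure)
  assumes Dom_in_Obj: "f \<in> Arr C \<Longrightarrow> Dom C f \<in> Obj C"
    and Cod_in_Obj: "f \<in> Arr C \<Longrightarrow> Cod C f \<in> Obj C"
    and Id_in_hom: "a \<in> Obj C \<Longrightarrow> Id C a \<in> hom C a a"
    and Comp_in_hom: "\<lbrakk>f \<in> hom C a b; g \<in> hom C b c\<rbrakk> \<Longrightarrow> g \<cdot> f \<in> hom C a c"
    and Comp_Id: "f \<in> hom C a b \<Longrightarrow> f \<cdot> Id C a = f"
    and Id_Comp: "f \<in> hom C a b \<Longrightarrow> Id C b \<cdot> f = f"
    and Comp_assoc: "\<lbrakk>f \<in> hom C a b; g \<in> hom C b c; h \<in> hom C c d\<rbrakk>
        \<Longrightarrow> (h \<cdot> g) \<cdot> f = h \<cdot> (g \<cdot> f)"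

record ('o1, 'm1, 'o2, 'm2) ftor =
  fobj :: "'o1 \<Rightarrow> 'o2"
  farr :: "'m1 \<Rightarrow> 'm2"

locale is_functor = A: category A + B: category B
  for A :: "('o1, 'm1) cat" and B :: "('o2, 'm2) cat" and F :: "('o1, 'm1, 'o2, 'm2) ftor" +
  assumes fobj_in_Obj: "a \<in> Obj A \<Longrightarrow> fobj F a \<in> Obj B"
    and farr_in_hom: "f \<in> hom A a b \<Longrightarrow> farr F f \<in> hom B (fobj F a) (fobj F b)"
    and farr_Id: "a \<in> Obj A \<Longrightarrow> farr F (Id A a) = Id B (fobj F a)"
    and farr_Comp: "\<lbrakk>f \<in> hom A a b; g \<in> hom A b c\<rbrakk>
        \<Longrightarrow> farr F (g \<cdot>\<^bsub>A\<^esub> f) = farr F g \<cdot>\<^bsub>B\<^esub> farr F f"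


text \<open>Smallness is relative to an infinite regular cardinal \<open>\<Omega>\<close> on a type \<open>'u\<close>: a set (of any type)
  is small if its cardinality is strictly below \<open>\<Omega>\<close>. For inaccessible \<open>\<Omega>\<close> these are exactly the sets
  that are small with respect to the corresponding Grothendieck universe. The strict inequality is
  essential: bounding cardinalities by that of a fixed type instead would, by Freyd's argument, force
  every locally small cocomplete category to be a preorder.\<close>

definition size_cardinal :: "'u rel \<Rightarrow> bool" where
  "size_cardinal \<Omega> \<longleftrightarrow> Cinfinite \<Omega> \<and> regularCard \<Omega>"

definition small :: "'u rel \<Rightarrow> 'a set \<Rightarrow> bool" where
  "small \<Omega> A \<longleftrightarrow> |A| <o \<Omega>"

definition small_cat :: "'u rel \<Rightarrow> ('o, 'm) cat \<Rightarrow> bool" where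
  "small_cat \<Omega> C \<longleftrightarrow> small \<Omega> (Obj C) \<and> small \<Omega> (Arr C)"

definition locally_small :: "'u rel \<Rightarrow> ('o, 'm) cat \<Rightarrow> bool" where
  "locally_small \<Omega> C \<longleftrightarrow> (\<forall>a\<in>Obj C. \<forall>b\<in>Obj C. small \<Omega> (hom C a b))"


definition cocone ::
  "('i, 'k) cat \<Rightarrow> ('o, 'm) cat \<Rightarrow> ('i, 'k, 'o, 'm) ftor \<Rightarrow> 'o \<Rightarrow> ('i \<Rightarrow> 'm) \<Rightarrow> bool" where
  "cocone I C D c \<iota> \<longleftrightarrow> c \<in> Obj C \<and> (\<forall>i\<in>Obj I. \<iota> i \<in> hom C (fobj D i) c) \<and>
     (\<forall>i\<in>Obj I. \<forall>j\<in>Obj I. \<forall>\<alpha>\<in>hom I i j. \<iota> j \<cdot>\<^bsub>C\<^esub> farr D \<alpha> = \<iota> i)"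

definition is_colimit ::
  "('i, 'k) cat \<Rightarrow> ('o, 'm) cat \<Rightarrow> ('i, 'k, 'o, 'm) ftor \<Rightarrow> 'o \<Rightarrow> ('i \<Rightarrow> 'm) \<Rightarrow> bool" where
  "is_colimit I C D c \<iota> \<longleftrightarrow> cocone I C D c \<iota> \<and>
     (\<forall>c' \<iota>'. cocone I C D c' \<iota>' \<longrightarrow>
        (\<exists>!k. k \<in> hom C c c' \<and> (\<forall>i\<in>Obj I. k \<cdot>\<^bsub>C\<^esub> \<iota> i = \<iota>' i)))"

text \<open>Quantifying over index categories carried by the type \<open>'u\<close> of \<open>\<Omega>\<close> is no restriction: every
  small category is isomorphic to such a one.\<close>

definition cocomplete :: "'u rel \<Rightarrow> ('o, 'm) cat \<Rightarrow> bool" where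
  "cocomplete \<Omega> C \<longleftrightarrow>
     (\<forall>(I :: ('u, 'u) cat) D. small_cat \<Omega> I \<and> is_functor I C D \<longrightarrow> (\<exists>c \<iota>. is_colimit I C D c \<iota>))"

definition is_pushout :: "('o, 'm) cat \<Rightarrow> 'm \<Rightarrow> 'm \<Rightarrow> 'm \<Rightarrow> 'm \<Rightarrow> bool" where
  "is_pushout C h k p q \<longleftrightarrow>
     h \<in> Arr C \<and> k \<in> Arr C \<and> Dom C h = Dom C k \<and>
     p \<in> hom C (Cod C k) (Cod C p) \<and> q \<in> hom C (Cod C h) (Cod C p) \<and>
     p \<cdot>\<^bsub>C\<^esub> k = q \<cdot>\<^bsub>C\<^esub> h \<and>
     (\<forall>s p' q'. p' \<in> hom C (Cod C k) s \<and> q' \<in> hom C (Cod C h) s \<and> p' \<cdot>\<^bsub>C\<^esub> k = q' \<cdot>\<^bsub>C\<^esub> h \<longrightarrow>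
        (\<exists>!t. t \<in> hom C (Cod C p) s \<and> t \<cdot>\<^bsub>C\<^esub> p = p' \<and> t \<cdot>\<^bsub>C\<^esub> q = q'))"


text \<open>\<open>Square f g s0 s1\<close> is the commutative square from \<open>f\<close> to \<open>g\<close> with domain part \<open>s0\<close> and codomain
  part \<open>s1\<close>; it records \<open>f\<close> and \<open>g\<close>, so that hom-sets of the category of arrows are disjoint.\<close>

datatype 'm square = Square (sq_src: 'm) (sq_tgt: 'm) (sq0: 'm) (sq1: 'm)

definition arrow_cat :: "('o, 'm) cat \<Rightarrow> ('m, 'm square) cat" where
  "arrow_cat C =
    \<lparr>Obj = Arr C,
     Arr = {Square f g s0 s1 | f g s0 s1.
              f \<in> Arr C \<and> g \<in> Arr C \<and>
              s0 \<in> hom C (Dom C f) (Dom C g) \<and> s1 \<in> hom C (Cod C f) (Cod C g) \<and>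
              g \<cdot>\<^bsub>C\<^esub> s0 = s1 \<cdot>\<^bsub>C\<^esub> f},
     Dom = sq_src,
     Cod = sq_tgt,
     Id = (\<lambda>f. Square f f (Id C (Dom C f)) (Id C (Cod C f))),
     Comp = (\<lambda>t s. Square (sq_src s) (sq_tgt t) (sq0 t \<cdot>\<^bsub>C\<^esub> sq0 s) (sq1 t \<cdot>\<^bsub>C\<^esub> sq1 s))\<rparr>"

text \<open>A morphism \<open>\<alpha>\<close> from \<open>x\<close> to \<open>y\<close> of the comma category is encoded as \<open>(x, \<alpha>, y)\<close>.\<close>

definition comma ::
  "('j, 'a) cat \<Rightarrow> ('o, 'm) cat \<Rightarrow> ('j, 'a, 'o, 'm) ftor \<Rightarrow> 'o
     \<Rightarrow> ('j \<times> 'm, ('j \<times> 'm) \<times> 'a \<times> ('j \<times> 'm)) cat" where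
  "comma J B U f =
    (let X = (SIGMA j:Obj J. hom B (fobj U j) f) in
     \<lparr>Obj = X,
      Arr = {((i, \<tau>), \<alpha>, (j, \<sigma>)) | i \<tau> \<alpha> j \<sigma>.
               (i, \<tau>) \<in> X \<and> (j, \<sigma>) \<in> X \<and> \<alpha> \<in> hom J i j \<and> \<sigma> \<cdot>\<^bsub>B\<^esub> farr U \<alpha> = \<tau>},
      Dom = (\<lambda>(x, \<alpha>, y). x),
      Cod = (\<lambda>(x, \<alpha>, y). y),
      Id = (\<lambda>x. (x, Id J (fst x), x)),
      Comp = (\<lambda>(y', \<beta>, z) (x, \<alpha>, y). (x, \<beta> \<cdot>\<^bsub>J\<^esub> \<alpha>, z))\<rparr>)"

definition comma_diagram ::
  "('j, 'a, 'o, 'm) ftor \<Rightarrow> ('j \<times> 'm, ('j \<times> 'm) \<times> 'a \<times> ('j \<times> 'm), 'o, 'm) ftor" where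
  "comma_diagram U = \<lparr>fobj = (\<lambda>(j, \<sigma>). fobj U j), farr = (\<lambda>(x, \<alpha>, y). farr U \<alpha>)\<rparr>"


text \<open>Construction of \<open>T f\<close>. The colimit and the pushout are determined only up to isomorphism; they
  are chosen by \<open>SOME\<close>.\<close>

definition density_colimit ::
  "('j, 'a) cat \<Rightarrow> ('o, 'm) cat \<Rightarrow> ('j, 'a, 'm, 'm square) ftor \<Rightarrow> 'm
     \<Rightarrow> 'm \<times> ('j \<times> 'm square \<Rightarrow> 'm square)" where
  "density_colimit J C U f =
     (SOME (c, \<iota>). is_colimit (comma J (arrow_cat C) U f) (arrow_cat C) (comma_diagram U) c \<iota>)"

definition C_of ::
  "('j, 'a) cat \<Rightarrow> ('o, 'm) cat \<Rightarrow> ('j, 'a, 'm, 'm square) ftor \<Rightarrow> 'm \<Rightarrow> 'm" where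
  "C_of J C U f = fst (density_colimit J C U f)"

definition C_coproj ::
  "('j, 'a) cat \<Rightarrow> ('o, 'm) cat \<Rightarrow> ('j, 'a, 'm, 'm square) ftor \<Rightarrow> 'm
     \<Rightarrow> 'j \<times> 'm square \<Rightarrow> 'm square" where
  "C_coproj J C U f = snd (density_colimit J C U f)"

definition eps ::
  "('j, 'a) cat \<Rightarrow> ('o, 'm) cat \<Rightarrow> ('j, 'a, 'm, 'm square) ftor \<Rightarrow> 'm \<Rightarrow> 'm square" where
  "eps J C U f =
     (THE e. e \<in> hom (arrow_cat C) (C_of J C U f) f \<and>
        (\<forall>(j, \<sigma>) \<in> Obj (comma J (arrow_cat C) U f).
           e \<cdot>\<^bsub>arrow_cat C\<^esub> C_coproj J C U f (j, \<sigma>) = \<sigma>))"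

definition S_pushout ::
  "('j, 'a) cat \<Rightarrow> ('o, 'm) cat \<Rightarrow> ('j, 'a, 'm, 'm square) ftor \<Rightarrow> 'm \<Rightarrow> 'm \<times> 'm" where
  "S_pushout J C U f = (SOME (p, q). is_pushout C (C_of J C U f) (sq0 (eps J C U f)) p q)"

definition K_of ::
  "('j, 'a) cat \<Rightarrow> ('o, 'm) cat \<Rightarrow> ('j, 'a, 'm, 'm square) ftor \<Rightarrow> 'm \<Rightarrow> 'm" where
  "K_of J C U f = fst (S_pushout J C U f)"

definition q_of ::
  "('j, 'a) cat \<Rightarrow> ('o, 'm) cat \<Rightarrow> ('j, 'a, 'm, 'm square) ftor \<Rightarrow> 'm \<Rightarrow> 'm" where
  "q_of J C U f = snd (S_pushout J C U f)"

definition S_of ::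
  "('j, 'a) cat \<Rightarrow> ('o, 'm) cat \<Rightarrow> ('j, 'a, 'm, 'm square) ftor \<Rightarrow> 'm \<Rightarrow> 'o" where
  "S_of J C U f = Cod C (K_of J C U f)"

definition T_of ::
  "('j, 'a) cat \<Rightarrow> ('o, 'm) cat \<Rightarrow> ('j, 'a, 'm, 'm square) ftor \<Rightarrow> 'm \<Rightarrow> 'm" where
  "T_of J C U f =
     (THE t. t \<in> hom C (S_of J C U f) (Cod C f) \<and>
        t \<cdot>\<^bsub>C\<^esub> K_of J C U f = f \<and> t \<cdot>\<^bsub>C\<^esub> q_of J C U f = sq1 (eps J C U f))"


text \<open>The family \<open>\<phi>\<close> is a function of pairs \<open>(j, \<sigma>)\<close> with \<open>\<sigma> : U j \<rightarrow> f\<close>, extended by \<open>undefined\<close>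
  outside of this domain, so that equality of structures is equality of families.\<close>

definition lifting_dom ::
  "('j, 'a) cat \<Rightarrow> ('o, 'm) cat \<Rightarrow> ('j, 'a, 'm, 'm square) ftor \<Rightarrow> 'm \<Rightarrow> ('j \<times> 'm square) set" where
  "lifting_dom J C U f = (SIGMA j:Obj J. hom (arrow_cat C) (fobj U j) f)"

definition one_step ::
  "('j, 'a) cat \<Rightarrow> ('o, 'm) cat \<Rightarrow> ('j, 'a, 'm, 'm square) ftor \<Rightarrow> 'm \<Rightarrow> 'm
     \<Rightarrow> ('m square \<times> ('j \<times> 'm square \<Rightarrow> 'm)) set" where
  "one_step J C U f g =
     {(u, \<phi>).
        u \<in> hom (arrow_cat C) f g \<and>
        \<phi> \<in> extensional (lifting_dom J C U f) \<and>
        (\<forall>j\<in>Obj J. \<forall>\<sigma>\<in>hom (arrow_cat C) (fobj U j) f.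
           \<phi> (j, \<sigma>) \<in> hom C (Cod C (fobj U j)) (Dom C g) \<and>
           \<phi> (j, \<sigma>) \<cdot>\<^bsub>C\<^esub> fobj U j = sq0 u \<cdot>\<^bsub>C\<^esub> sq0 \<sigma> \<and>
           g \<cdot>\<^bsub>C\<^esub> \<phi> (j, \<sigma>) = sq1 u \<cdot>\<^bsub>C\<^esub> sq1 \<sigma>) \<and>
        (\<forall>i\<in>Obj J. \<forall>j\<in>Obj J. \<forall>\<alpha>\<in>hom J i j. \<forall>\<sigma>\<in>hom (arrow_cat C) (fobj U j) f.
           \<phi> (i, \<sigma> \<cdot>\<^bsub>arrow_cat C\<^esub> farr U \<alpha>) = \<phi> (j, \<sigma>) \<cdot>\<^bsub>C\<^esub> sq1 (farr U \<alpha>))}"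

definition one_step_map ::
  "('j, 'a) cat \<Rightarrow> ('o, 'm) cat \<Rightarrow> ('j, 'a, 'm, 'm square) ftor \<Rightarrow> 'm \<Rightarrow> 'm square
     \<Rightarrow> 'm square \<times> ('j \<times> 'm square \<Rightarrow> 'm) \<Rightarrow> 'm square \<times> ('j \<times> 'm square \<Rightarrow> 'm)" where
  "one_step_map J C U f b =
     (\<lambda>(u, \<phi>). (b \<cdot>\<^bsub>arrow_cat C\<^esub> u, restrict (\<lambda>x. sq0 b \<cdot>\<^bsub>C\<^esub> \<phi> x) (lifting_dom J C U f)))"

end

theory Submission
  imports Defs
begin

text \<open>A square \<open>h : Tf \<rightarrow> g\<close> is a pair \<open>(h\<^sub>0, h\<^sub>1)\<close>, and by the universal property of the pushout \<open>Sf\<close>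
  the map \<open>h\<^sub>0\<close> amounts to \<open>h\<^sub>0 \<circ> Kf\<close> together with \<open>h\<^sub>0 \<circ> q\<^sub>f\<close>. The former makes \<open>u = (h\<^sub>0 \<circ> Kf, h\<^sub>1)\<close> a
  square from \<open>f\<close> to \<open>g\<close>; the latter, restricted along the colimit coprojections of \<open>Cf\<close>, is the family
  \<open>\<phi>\<close>. Conversely \<open>\<phi>\<close> is turned back into a map out of the codomain of \<open>Cf\<close> by regarding maps into an
  object as squares into its identity.\<close>

subsection \<open>Small sets and small colimits\<close>

text \<open>The data in the statement come from \<open>SOME\<close> and \<open>THE\<close>, so
  nothing can be said about them until the colimit and the pushout are known to exist.
  Cocompleteness speaks only of index categories carried by \<open>'u\<close> and of diagrams in
  \<open>C\<close>, whereas the diagram defining \<open>Cf\<close> is indexed by a comma category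
  over another type and takes values in the category of arrows. Much of the proof bridges this gap:
  the comma category is small because its objects form a \<open>J\<close>-indexed sum of small
  hom-sets, a small index category can be recoded inside \<open>'u\<close>, and colimits of arrows
  are built from two colimits in \<open>C\<close>. The chosen \<open>Cf\<close> is then an arbitrary
  colimit, so all further facts have to be read off universal properties in the category of arrows.
  Sending an object \<open>a\<close> to \<open>Id C a\<close> is right adjoint to taking codomains,
  which is why identities are the right test objects for the codomain of \<open>Cf\<close>.\<close>

lemma small_mono: "A \<subseteq> B \<Longrightarrow> small \<Omega> B \<Longrightarrow> small \<Omega> A"
  unfolding small_def using card_of_mono1 ordLeq_ordLess_trans by blast

lemma small_image: "small \<Omega> A \<Longrightarrow> small \<Omega> (f ` A)"
  unfolding small_def using card_of_image ordLeq_ordLess_trans by blast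

text \<open>Regularity of \<open>\<Omega>\<close> is used here: a regular infinite cardinal is
  stable, that is, not reached by a sum of fewer, smaller cardinals.\<close>

lemma small_Sigma:
  assumes "size_cardinal \<Omega>" "small \<Omega> A" "\<And>a. a \<in> A \<Longrightarrow> small \<Omega> (B a)"
  shows "small \<Omega> (Sigma A B)"
  using assms stable_elim[of \<Omega> A B] regularCard_stable
  unfolding size_cardinal_def small_def cinfinite_def by blast

lemma small_Times:
  "size_cardinal \<Omega> \<Longrightarrow> small \<Omega> A \<Longrightarrow> small \<Omega> B \<Longrightarrow> small \<Omega> (A \<times> B)"
  by (simp add: small_Sigma)

lemma small_finite:
  assumes "size_cardinal \<Omega>" "finite A"
  shows "small \<Omega> A"
  using assms Cfinite_ordLess_Cinfinite[of "|A|" \<Omega>] card_of_Card_order[of A]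
  unfolding size_cardinal_def small_def cfinite_def Field_card_of by simp

text \<open>Supplies the codes in \<open>'u\<close> under which a small index category of arbitrary
  type becomes one that \<open>cocomplete\<close> speaks about.\<close>

lemma small_inj_on:
  fixes \<Omega> :: "'u rel"
  assumes "size_cardinal \<Omega>" "small \<Omega> A"
  obtains e :: "'a \<Rightarrow> 'u" where "inj_on e A"
proof -
  have "|A| \<le>o \<Omega>"
    using assms ordLess_imp_ordLeq unfolding small_def by blast
  then have "|A| \<le>o |Field \<Omega>|"
    using assms(1) card_of_Field_ordIso ordIso_symmetric ordLeq_ordIso_trans
    unfolding size_cardinal_def by blast
  then show thesis
    using that card_of_ordLeq[of A "Field \<Omega>"] by blast
qed

section \<open>Transport of diagrams along a recoding of the index category\<close>

lemma homD:
  assumes "f \<in> hom C a b"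
  shows "f \<in> Arr C" "Dom C f = a" "Cod C f = b"
  using assms by (auto simp: hom_def)

lemma (in category) hom_Obj:
  assumes "f \<in> hom C a b"
  shows "a \<in> Obj C" "b \<in> Obj C"
  using assms Dom_in_Obj Cod_in_Obj by (auto simp: hom_def)

lemma (in category) Arr_hom: "f \<in> Arr C \<Longrightarrow> f \<in> hom C (Dom C f) (Cod C f)"
  by (simp add: hom_def)

text \<open>Recoding objects and arrows through two unrelated injections changes nothing but names,
  so cocones correspond, and colimits with them. Only the passage back from the copy to
  \<open>A\<close> is stated. The maps are injective on the carriers only, hence the decoding by
  \<open>inv_into\<close> throughout.\<close>

lemma (in is_functor) is_colimit_transport:
  assumes e: "inj_on e (Obj A)" and m: "inj_on m (Arr A)"
  obtains I D where "is_functor I B D" "Obj I = e ` Obj A" "Arr I = m ` Arr A"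
    and "\<And>c \<iota>. is_colimit I B D c \<iota> \<Longrightarrow> is_colimit A B F c (\<lambda>i. \<iota> (e i))"
proof -
  define I where "I = \<lparr>Obj = e ` Obj A, Arr = m ` Arr A,
       Dom = \<lambda>x. e (Dom A (inv_into (Arr A) m x)),
       Cod = \<lambda>x. e (Cod A (inv_into (Arr A) m x)),
       Id = \<lambda>y. m (Id A (inv_into (Obj A) e y)),
       Comp = \<lambda>x y. m (inv_into (Arr A) m x \<cdot>\<^bsub>A\<^esub> inv_into (Arr A) m y)\<rparr>"
  define D where
    "D = \<lparr>fobj = \<lambda>y. fobj F (inv_into (Obj A) e y), farr = \<lambda>x. farr F (inv_into (Arr A) m x)\<rparr>"
  have ie [simp]: "inv_into (Obj A) e (e a) = a" if "a \<in> Obj A" for a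
    using that e by simp
  have im [simp]: "inv_into (Arr A) m (m a) = a" if "a \<in> Arr A" for a
    using that m by simp
  have homI_iff: "hom I (e a) (e b) = m ` hom A a b" if "a \<in> Obj A" "b \<in> Obj A" for a b
    using that A.Dom_in_Obj A.Cod_in_Obj e unfolding hom_def I_def
    by (auto simp: inj_on_eq_iff)
  \<comment> \<open>Arrows of \<open>I\<close> are handled by decoding them to arrows of
    \<open>A\<close>. Composable arrows yield two decodings of the middle object, which injectivity
    of \<open>e\<close> identifies.\<close>
  have homE: "\<exists>a b f. a \<in> Obj A \<and> b \<in> Obj A \<and> x = e a \<and> y = e b \<and> f \<in> hom A a b \<and> s = m f"
    if "s \<in> hom I x y" for s x y
    using that A.Dom_in_Obj A.Cod_in_Obj unfolding hom_def I_def by fastforce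
  have comp [simp]: "m g \<cdot>\<^bsub>I\<^esub> m f = m (g \<cdot>\<^bsub>A\<^esub> f)" if "g \<in> hom A b c" "f \<in> hom A a b" for f g a b c
    using homD(1)[OF that(1)] homD(1)[OF that(2)] by (simp add: I_def)
  have Id [simp]: "Id I (e a) = m (Id A a)" if "a \<in> Obj A" for a
    using that by (simp add: I_def)
  have ObjI: "Obj I = e ` Obj A"
    by (simp add: I_def)
  have eq: "a = b" if "e a = e b" "a \<in> Obj A" "b \<in> Obj A" for a b
    using that e by (meson inj_onD)
  have fD [simp]: "fobj D (e a) = fobj F a" if "a \<in> Obj A" for a
    using that by (simp add: D_def)
  have aD [simp]: "farr D (m f) = farr F f" if "f \<in> hom A a b" for f a b
    using homD(1)[OF that] by (simp add: D_def)
  have cat: "category I"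
  proof
    show "Dom I s \<in> Obj I" "Cod I s \<in> Obj I" if "s \<in> Arr I" for s
      using that A.Dom_in_Obj A.Cod_in_Obj by (auto simp: I_def)
    show "Id I x \<in> hom I x x" if "x \<in> Obj I" for x
      using that A.Id_in_hom by (auto simp: homI_iff ObjI)
    show "t \<cdot>\<^bsub>I\<^esub> s \<in> hom I x z" if st: "s \<in> hom I x y" "t \<in> hom I y z" for s t x y z
    proof -
      obtain a b f where f: "a \<in> Obj A" "b \<in> Obj A" "x = e a" "y = e b" "f \<in> hom A a b" "s = m f"
        using homE[OF st(1)] by blast
      obtain b' c g where g: "b' \<in> Obj A" "c \<in> Obj A" "y = e b'" "z = e c" "g \<in> hom A b' c" "t = m g"
        using homE[OF st(2)] by blast
      have [simp]: "b' = b"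
        using f g eq by auto
      show ?thesis
        using f g A.Comp_in_hom by (auto simp: homI_iff comp[of _ b c _ a])
    qed
    show "s \<cdot>\<^bsub>I\<^esub> Id I x = s" "Id I y \<cdot>\<^bsub>I\<^esub> s = s" if s: "s \<in> hom I x y" for s x y
    proof -
      obtain a b f where f: "a \<in> Obj A" "b \<in> Obj A" "x = e a" "y = e b" "f \<in> hom A a b" "s = m f"
        using homE[OF s] by blast
      show "s \<cdot>\<^bsub>I\<^esub> Id I x = s" "Id I y \<cdot>\<^bsub>I\<^esub> s = s"
        using f by (simp_all add: comp[OF f(5) A.Id_in_hom] comp[OF A.Id_in_hom f(5)] A.Comp_Id A.Id_Comp)
    qed
    show "u \<cdot>\<^bsub>I\<^esub> t \<cdot>\<^bsub>I\<^esub> s = u \<cdot>\<^bsub>I\<^esub> (t \<cdot>\<^bsub>I\<^esub> s)"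
      if st: "s \<in> hom I x y" "t \<in> hom I y z" "u \<in> hom I z w" for s t u x y z w
    proof -
      obtain a b f where f: "a \<in> Obj A" "b \<in> Obj A" "x = e a" "y = e b" "f \<in> hom A a b" "s = m f"
        using homE[OF st(1)] by blast
      obtain b' c g where g: "b' \<in> Obj A" "c \<in> Obj A" "y = e b'" "z = e c" "g \<in> hom A b' c" "t = m g"
        using homE[OF st(2)] by blast
      obtain c' d h where h: "c' \<in> Obj A" "d \<in> Obj A" "z = e c'" "w = e d" "h \<in> hom A c' d" "u = m h"
        using homE[OF st(3)] by blast
      have [simp]: "b' = b" "c' = c"
        using f g h eq by auto
      have fgh: "f \<in> hom A a b" "g \<in> hom A b c" "h \<in> hom A c d"
        using f g h by simp_all
      show ?thesis
        unfolding f(6) g(6) h(6)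
        by (simp add: comp[OF fgh(3,2)] comp[OF fgh(2,1)] comp[OF A.Comp_in_hom[OF fgh(2,3)] fgh(1)]
            comp[OF fgh(3) A.Comp_in_hom[OF fgh(1,2)]] A.Comp_assoc[OF fgh])
    qed
  qed
  have F: "is_functor I B D"
  proof (intro is_functor.intro is_functor_axioms.intro cat B.category_axioms)
    show "fobj D x \<in> Obj B" if "x \<in> Obj I" for x
      using that fobj_in_Obj by (auto simp: ObjI)
    show "farr D s \<in> hom B (fobj D x) (fobj D y)" if s: "s \<in> hom I x y" for s x y
    proof -
      obtain a b f where f: "a \<in> Obj A" "b \<in> Obj A" "x = e a" "y = e b" "f \<in> hom A a b" "s = m f"
        using homE[OF s] by blast
      then show ?thesis
        by (simp add: farr_in_hom aD[OF f(5)])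
    qed
    show "farr D (Id I x) = Id B (fobj D x)" if "x \<in> Obj I" for x
      using that by (auto simp: ObjI aD[OF A.Id_in_hom] farr_Id)
    show "farr D (t \<cdot>\<^bsub>I\<^esub> s) = farr D t \<cdot>\<^bsub>B\<^esub> farr D s"
      if st: "s \<in> hom I x y" "t \<in> hom I y z" for s t x y z
    proof -
      obtain a b f where f: "a \<in> Obj A" "b \<in> Obj A" "x = e a" "y = e b" "f \<in> hom A a b" "s = m f"
        using homE[OF st(1)] by blast
      obtain b' c g where g: "b' \<in> Obj A" "c \<in> Obj A" "y = e b'" "z = e c" "g \<in> hom A b' c" "t = m g"
        using homE[OF st(2)] by blast
      have [simp]: "b' = b"
        using f g eq by auto
      have fg: "f \<in> hom A a b" "g \<in> hom A b c"
        using f g by simp_all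
      show ?thesis
        unfolding f(6) g(6)
        by (simp add: comp[OF fg(2,1)] aD[OF fg(1)] aD[OF fg(2)] aD[OF A.Comp_in_hom[OF fg]] farr_Comp[OF fg])
    qed
  qed
  have coc: "cocone A B F c (\<lambda>i. \<iota> (e i)) \<longleftrightarrow> cocone I B D c \<iota>" for c \<iota>
    unfolding cocone_def ObjI by (auto simp: homI_iff aD)
  have colim: "is_colimit A B F c (\<lambda>i. \<iota> (e i))" if col: "is_colimit I B D c \<iota>" for c \<iota>
  proof -
    have "\<exists>!k. k \<in> hom B c c' \<and> (\<forall>i\<in>Obj A. k \<cdot>\<^bsub>B\<^esub> \<iota> (e i) = \<iota>' i)"
      if c': "cocone A B F c' \<iota>'" for c' \<iota>'
    proof -
      \<comment> \<open>\<open>coc\<close> applies only to families that factor through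
        \<open>e\<close>, so \<open>\<iota>'\<close> is first replaced by such a family agreeing
        with it on the objects of \<open>A\<close>.\<close>
      have "cocone A B F c' (\<lambda>i. \<iota>' (inv_into (Obj A) e (e i)))"
        using c' unfolding cocone_def by simp
      then have "cocone I B D c' (\<lambda>y. \<iota>' (inv_into (Obj A) e y))"
        by (simp add: coc[of c' "\<lambda>y. \<iota>' (inv_into (Obj A) e y)"])
      then have "\<exists>!k. k \<in> hom B c c' \<and> (\<forall>i\<in>Obj I. k \<cdot>\<^bsub>B\<^esub> \<iota> i = \<iota>' (inv_into (Obj A) e i))"
        using col unfolding is_colimit_def by blast
      then show ?thesis
        by (simp add: ObjI)
    qed
    then show ?thesis
      using col coc unfolding is_colimit_def by blast
  qed
  show thesis
    by (rule that[OF F _ _ colim]) (simp_all add: I_def)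
qed

text \<open>Frees \<open>cocomplete\<close> from index categories on \<open>'u\<close>, as needed
  for comma categories and for the span shape on numbers.\<close>

lemma cocomplete_colimit:
  fixes \<Omega> :: "'u rel" and I :: "('i, 'k) cat"
  assumes \<Omega>: "size_cardinal \<Omega>" and cc: "cocomplete \<Omega> C"
    and I: "small_cat \<Omega> I" and D: "is_functor I C D"
  shows "\<exists>c \<iota>. is_colimit I C D c \<iota>"
proof -
  have sm: "small \<Omega> (Obj I)" "small \<Omega> (Arr I)"
    using I by (simp_all add: small_cat_def)
  obtain e :: "'i \<Rightarrow> 'u" where e: "inj_on e (Obj I)"
    using small_inj_on[OF \<Omega> sm(1)] .
  obtain m :: "'k \<Rightarrow> 'u" where m: "inj_on m (Arr I)"
    using small_inj_on[OF \<Omega> sm(2)] .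
  obtain I' :: "('u, 'u) cat" and D' where F: "is_functor I' C D'"
    and I': "Obj I' = e ` Obj I" "Arr I' = m ` Arr I"
    and col: "\<And>c \<iota>. is_colimit I' C D' c \<iota> \<Longrightarrow> is_colimit I C D c (\<lambda>i. \<iota> (e i))"
    by (rule is_functor.is_colimit_transport[OF D e m], rule that)
  have "small_cat \<Omega> I'"
    using sm by (simp add: small_cat_def I' small_image)
  then obtain c \<iota> where "is_colimit I' C D' c \<iota>"
    using cc F unfolding cocomplete_def by blast
  then show ?thesis
    using col by blast
qed

subsection \<open>The category of arrows and comma categories\<close>

lemma arrow_cat_simps [simp]:
  "Obj (arrow_cat C) = Arr C" "Dom (arrow_cat C) = sq_src" "Cod (arrow_cat C) = sq_tgt"
  "Id (arrow_cat C) f = Square f f (Id C (Dom C f)) (Id C (Cod C f))"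
  "t \<cdot>\<^bsub>arrow_cat C\<^esub> s =
     Square (sq_src s) (sq_tgt t) (sq0 t \<cdot>\<^bsub>C\<^esub> sq0 s) (sq1 t \<cdot>\<^bsub>C\<^esub> sq1 s)"
  by (simp_all add: arrow_cat_def)

lemma arrow_hom_iff:
  "s \<in> hom (arrow_cat C) f g \<longleftrightarrow>
     f \<in> Arr C \<and> g \<in> Arr C \<and> sq_src s = f \<and> sq_tgt s = g \<and>
     sq0 s \<in> hom C (Dom C f) (Dom C g) \<and> sq1 s \<in> hom C (Cod C f) (Cod C g) \<and>
     g \<cdot>\<^bsub>C\<^esub> sq0 s = sq1 s \<cdot>\<^bsub>C\<^esub> f"
  by (cases s) (auto simp: hom_def arrow_cat_def)

lemma arrow_homD:
  assumes "s \<in> hom (arrow_cat C) f g"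
  shows "f \<in> Arr C" "g \<in> Arr C" "sq_src s = f" "sq_tgt s = g"
    "sq0 s \<in> hom C (Dom C f) (Dom C g)" "sq1 s \<in> hom C (Cod C f) (Cod C g)"
    "g \<cdot>\<^bsub>C\<^esub> sq0 s = sq1 s \<cdot>\<^bsub>C\<^esub> f"
  using assms by (auto simp: arrow_hom_iff)

text \<open>Between fixed ends a square is determined by its two components, so local smallness
  passes from \<open>C\<close> to its category of arrows.\<close>

lemma small_arrow_hom:
  assumes \<Omega>: "size_cardinal \<Omega>" and C: "category C" and ls: "locally_small \<Omega> C"
    and f: "f \<in> Arr C" and g: "g \<in> Arr C"
  shows "small \<Omega> (hom (arrow_cat C) f g)"
proof -
  interpret category C
    by (rule C)
  let ?P = "hom C (Dom C f) (Dom C g) \<times> hom C (Cod C f) (Cod C g)"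
  have "small \<Omega> ?P"
    using small_Times[OF \<Omega>] ls f g Dom_in_Obj Cod_in_Obj unfolding locally_small_def by blast
  then have "small \<Omega> ((\<lambda>(s0, s1). Square f g s0 s1) ` ?P)"
    by (rule small_image)
  moreover have "hom (arrow_cat C) f g \<subseteq> (\<lambda>(s0, s1). Square f g s0 s1) ` ?P"
  proof
    fix s
    assume s: "s \<in> hom (arrow_cat C) f g"
    show "s \<in> (\<lambda>(s0, s1). Square f g s0 s1) ` ?P"
      by (rule image_eqI[of _ _ "(sq0 s, sq1 s)"]) (use arrow_homD[OF s] in \<open>cases s; simp\<close>)+
  qed
  ultimately show ?thesis
    by (blast intro: small_mono)
qed

lemma (in is_functor) comma_simps [simp]:
  "Obj (comma A B F f) = (SIGMA j:Obj A. hom B (fobj F j) f)"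
  "Dom (comma A B F f) (x, \<alpha>, y) = x" "Cod (comma A B F f) (x, \<alpha>, y) = y"
  "Id (comma A B F f) x = (x, Id A (fst x), x)"
  "(y', \<beta>, z) \<cdot>\<^bsub>comma A B F f\<^esub> (x, \<alpha>, y) = (x, \<beta> \<cdot>\<^bsub>A\<^esub> \<alpha>, z)"
  by (simp_all add: comma_def Let_def)

lemma (in is_functor) comma_hom_iff:
  "s \<in> hom (comma A B F f) (i, \<tau>) (j, \<sigma>) \<longleftrightarrow>
     (\<exists>\<alpha>. s = ((i, \<tau>), \<alpha>, (j, \<sigma>)) \<and> i \<in> Obj A \<and> j \<in> Obj A \<and> \<tau> \<in> hom B (fobj F i) f \<and>
        \<sigma> \<in> hom B (fobj F j) f \<and> \<alpha> \<in> hom A i j \<and> \<sigma> \<cdot>\<^bsub>B\<^esub> farr F \<alpha> = \<tau>)"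
  unfolding hom_def[of "comma A B F f"] by (auto simp: comma_def Let_def)

lemma (in is_functor) category_comma: "category (comma A B F f)"
proof
  show "Dom (comma A B F f) s \<in> Obj (comma A B F f)" "Cod (comma A B F f) s \<in> Obj (comma A B F f)"
    if "s \<in> Arr (comma A B F f)" for s
    using that by (auto simp: comma_def Let_def)
  show "Id (comma A B F f) x \<in> hom (comma A B F f) x x" if "x \<in> Obj (comma A B F f)" for x
    using that A.Id_in_hom
    by (cases x) (auto simp: comma_hom_iff farr_Id B.Comp_Id)
  show "s \<cdot>\<^bsub>comma A B F f\<^esub> Id (comma A B F f) x = s"
    "Id (comma A B F f) y \<cdot>\<^bsub>comma A B F f\<^esub> s = s"
    if "s \<in> hom (comma A B F f) x y" for s x y
    using that by (cases x; cases y; auto simp: comma_hom_iff A.Comp_Id A.Id_Comp)+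
  show "t \<cdot>\<^bsub>comma A B F f\<^esub> s \<in> hom (comma A B F f) x z"
    if st: "s \<in> hom (comma A B F f) x y" "t \<in> hom (comma A B F f) y z" for s t x y z
  proof -
    obtain i \<rho> j \<sigma> k \<tau> where xyz: "x = (i, \<rho>)" "y = (j, \<sigma>)" "z = (k, \<tau>)"
      by (metis surj_pair)
    obtain \<alpha> where \<alpha>: "s = (x, \<alpha>, y)" "i \<in> Obj A" "\<rho> \<in> hom B (fobj F i) f"
      "\<alpha> \<in> hom A i j" "\<sigma> \<cdot>\<^bsub>B\<^esub> farr F \<alpha> = \<rho>"
      using st(1) by (auto simp: xyz comma_hom_iff)
    obtain \<beta> where \<beta>: "t = (y, \<beta>, z)" "k \<in> Obj A" "\<tau> \<in> hom B (fobj F k) f"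
      "\<beta> \<in> hom A j k" "\<tau> \<cdot>\<^bsub>B\<^esub> farr F \<beta> = \<sigma>"
      using st(2) by (auto simp: xyz comma_hom_iff)
    \<comment> \<open>The triangle over the composite is obtained by pasting the two given
      triangles.\<close>
    have "\<tau> \<cdot>\<^bsub>B\<^esub> farr F (\<beta> \<cdot>\<^bsub>A\<^esub> \<alpha>) = \<rho>"
      using B.Comp_assoc[OF farr_in_hom[OF \<alpha>(4)] farr_in_hom[OF \<beta>(4)] \<beta>(3)]
      by (simp add: farr_Comp[OF \<alpha>(4) \<beta>(4)] \<alpha>(5) \<beta>(5))
    then show ?thesis
      using \<alpha>(1-4) \<beta>(1-4) A.Comp_in_hom by (auto simp: xyz comma_hom_iff)
  qed
  show "u \<cdot>\<^bsub>comma A B F f\<^esub> t \<cdot>\<^bsub>comma A B F f\<^esub> s = u \<cdot>\<^bsub>comma A B F f\<^esub> (t \<cdot>\<^bsub>comma A B F f\<^esub> s)"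
    if "s \<in> hom (comma A B F f) x y" "t \<in> hom (comma A B F f) y z" "u \<in> hom (comma A B F f) z w"
    for s t u x y z w
    using that by (cases x; cases y; cases z; cases w) (auto simp: comma_hom_iff A.Comp_assoc)
qed

lemma (in is_functor) is_functor_comma_diagram:
  "is_functor (comma A B F f) B (comma_diagram F)"
proof (intro is_functor.intro is_functor_axioms.intro category_comma B.category_axioms)
  show "fobj (comma_diagram F) x \<in> Obj B" if "x \<in> Obj (comma A B F f)" for x
    using that fobj_in_Obj by (auto simp: comma_diagram_def)
  show "farr (comma_diagram F) s \<in> hom B (fobj (comma_diagram F) x) (fobj (comma_diagram F) y)"
    if "s \<in> hom (comma A B F f) x y" for s x y
    using that farr_in_hom by (cases x; cases y) (auto simp: comma_diagram_def comma_hom_iff)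
  show "farr (comma_diagram F) (Id (comma A B F f) x) = Id B (fobj (comma_diagram F) x)"
    if "x \<in> Obj (comma A B F f)" for x
    using that farr_Id by (auto simp: comma_diagram_def)
  show "farr (comma_diagram F) (t \<cdot>\<^bsub>comma A B F f\<^esub> s) =
      farr (comma_diagram F) t \<cdot>\<^bsub>B\<^esub> farr (comma_diagram F) s"
    if "s \<in> hom (comma A B F f) x y" "t \<in> hom (comma A B F f) y z" for s t x y z
    using that
    by (cases x; cases y; cases z) (auto simp: comma_diagram_def comma_hom_iff farr_Comp)
qed

text \<open>The objects form a sum of hom-sets indexed by the objects of \<open>A\<close>, and an
  arrow is a triple of two objects and an arrow of \<open>A\<close>. The premise on hom-sets is
  where local smallness will be used.\<close>

lemma (in is_functor) small_cat_comma:
  assumes "size_cardinal \<Omega>" "small_cat \<Omega> A" "\<And>j. j \<in> Obj A \<Longrightarrow> small \<Omega> (hom B (fobj F j) f)"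
  shows "small_cat \<Omega> (comma A B F f)"
proof -
  let ?X = "Obj (comma A B F f)"
  have X: "small \<Omega> ?X"
    using assms by (auto simp: small_cat_def intro: small_Sigma)
  have "small \<Omega> (?X \<times> Arr A \<times> ?X)"
    using assms X by (intro small_Times) (auto simp: small_cat_def)
  moreover have "Arr (comma A B F f) \<subseteq> ?X \<times> Arr A \<times> ?X"
    by (auto simp: comma_def Let_def hom_def)
  ultimately show ?thesis
    using X small_mono unfolding small_cat_def by blast
qed

subsection \<open>Colimits of arrows and pushouts\<close>

text \<open>Unique existence is split so that uniqueness becomes joint cancellation along the
  coprojections, which can be checked on the two components of a square separately.\<close>

lemma is_colimitI:
  assumes "cocone I C D c \<iota>"
    and "\<And>c' \<iota>'. cocone I C D c' \<iota>' \<Longrightarrow> \<exists>k. k \<in> hom C c c' \<and> (\<forall>i\<in>Obj I. k \<cdot>\<^bsub>C\<^esub> \<iota> i = \<iota>' i)"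
    and "\<And>c' k l. \<lbrakk>k \<in> hom C c c'; l \<in> hom C c c'; \<forall>i\<in>Obj I. k \<cdot>\<^bsub>C\<^esub> \<iota> i = l \<cdot>\<^bsub>C\<^esub> \<iota> i\<rbrakk> \<Longrightarrow> k = l"
  shows "is_colimit I C D c \<iota>"
proof -
  have "\<exists>!k. k \<in> hom C c c' \<and> (\<forall>i\<in>Obj I. k \<cdot>\<^bsub>C\<^esub> \<iota> i = \<iota>' i)" if "cocone I C D c' \<iota>'" for c' \<iota>'
    using assms(2)[OF that] assms(3)[of _ c'] by (metis (no_types, lifting))
  then show ?thesis
    using assms(1) by (simp add: is_colimit_def)
qed

lemma is_colimitD:
  assumes "is_colimit I C D c \<iota>"
  shows "c \<in> Obj C" "i \<in> Obj I \<Longrightarrow> \<iota> i \<in> hom C (fobj D i) c"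
    and "\<lbrakk>i \<in> Obj I; j \<in> Obj I; \<alpha> \<in> hom I i j\<rbrakk> \<Longrightarrow> \<iota> j \<cdot>\<^bsub>C\<^esub> farr D \<alpha> = \<iota> i"
  using assms unfolding is_colimit_def cocone_def by blast+

lemma is_colimit_desc:
  assumes "is_colimit I C D c \<iota>" "cocone I C D c' \<iota>'"
  shows "\<exists>k\<in>hom C c c'. \<forall>i\<in>Obj I. k \<cdot>\<^bsub>C\<^esub> \<iota> i = \<iota>' i"
  using assms unfolding is_colimit_def by blast

lemma (in category) cocone_Comp:
  assumes "is_functor I C D" and \<iota>: "cocone I C D c \<iota>" and k: "k \<in> hom C c d"
  shows "cocone I C D d (\<lambda>i. k \<cdot> \<iota> i)"
proof -
  interpret D: is_functor I C D
    by (rule assms)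
  have "k \<cdot> \<iota> j \<cdot> farr D \<alpha> = k \<cdot> \<iota> i"
    if "i \<in> Obj I" "j \<in> Obj I" and \<alpha>: "\<alpha> \<in> hom I i j" for i j \<alpha>
    using that \<iota> Comp_assoc[OF D.farr_in_hom[OF \<alpha>] _ k] unfolding cocone_def by simp
  then show ?thesis
    using \<iota> k hom_Obj Comp_in_hom unfolding cocone_def by blast
qed

text \<open>Composing \<open>k\<close> with the coprojections gives a cocone, and both
  \<open>k\<close> and \<open>l\<close> solve its factorization problem.\<close>

lemma (in category) is_colimit_joint_epi:
  assumes D: "is_functor I C D" and col: "is_colimit I C D c \<iota>"
    and k: "k \<in> hom C c d" and l: "l \<in> hom C c d" and eq: "\<And>i. i \<in> Obj I \<Longrightarrow> k \<cdot> \<iota> i = l \<cdot> \<iota> i"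
  shows "k = l"
proof -
  have "cocone I C D d (\<lambda>i. k \<cdot> \<iota> i)"
    using cocone_Comp[OF D _ k] col unfolding is_colimit_def by blast
  then have "\<exists>!m. m \<in> hom C c d \<and> (\<forall>i\<in>Obj I. m \<cdot> \<iota> i = k \<cdot> \<iota> i)"
    using col unfolding is_colimit_def by blast
  then show ?thesis
    using k l eq by metis
qed

text \<open>Colimits of arrows can be formed pointwise: the vertex is the map induced between the
  colimits of domains and of codomains. The two component diagrams enter through equations so that
  the conclusions can name them and \<open>refl\<close> can supply them.\<close>

lemma (in category) arrow_cat_colimit:
  assumes D: "is_functor I (arrow_cat C) D"
    and D0: "D0 = \<lparr>fobj = \<lambda>i. Dom C (fobj D i), farr = \<lambda>\<alpha>. sq0 (farr D \<alpha>)\<rparr>"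
    and D1: "D1 = \<lparr>fobj = \<lambda>i. Cod C (fobj D i), farr = \<lambda>\<alpha>. sq1 (farr D \<alpha>)\<rparr>"
  shows "is_functor I C D0" "is_functor I C D1"
    and "is_colimit I C D0 a \<iota>0 \<Longrightarrow> is_colimit I C D1 b \<iota>1 \<Longrightarrow> \<exists>c \<iota>. is_colimit I (arrow_cat C) D c \<iota>"
proof -
  interpret D: is_functor I "arrow_cat C" D
    by (rule D)
  note sq = arrow_homD[OF D.farr_in_hom]
  have DArr: "fobj D i \<in> Arr C" if "i \<in> Obj I" for i
    using D.fobj_in_Obj[OF that] by simp
  show F0: "is_functor I C D0" and F1: "is_functor I C D1"
    by (intro is_functor.intro is_functor_axioms.intro D.A.category_axioms category_axioms;
        auto simp: D0 D1 sq D.farr_Id D.farr_Comp DArr Dom_in_Obj Cod_in_Obj)+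
  assume c0: "is_colimit I C D0 a \<iota>0" and c1: "is_colimit I C D1 b \<iota>1"
  note i0 = is_colimitD[OF c0, unfolded D0, simplified]
    and i1 = is_colimitD[OF c1, unfolded D1, simplified]
  \<comment> \<open>The arrows \<open>fobj D i\<close> form a natural transformation from
    \<open>D0\<close> to \<open>D1\<close>; following it with the coprojections
    \<open>\<iota>1\<close> gives the cocone that induces the vertex \<open>c\<close>.\<close>
  have "cocone I C D0 b (\<lambda>i. \<iota>1 i \<cdot> fobj D i)"
    unfolding cocone_def
  proof (intro conjI ballI)
    show "b \<in> Obj C"
      by (rule i1)
    show "\<iota>1 i \<cdot> fobj D i \<in> hom C (fobj D0 i) b" if i: "i \<in> Obj I" for i
      using Comp_in_hom[OF Arr_hom[OF DArr[OF i]] i1(2)[OF i]] by (simp add: D0)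
    show "\<iota>1 j \<cdot> fobj D j \<cdot> farr D0 \<alpha> = \<iota>1 i \<cdot> fobj D i"
      if i: "i \<in> Obj I" and j: "j \<in> Obj I" and \<alpha>: "\<alpha> \<in> hom I i j" for i j \<alpha>
    proof -
      have "\<iota>1 j \<cdot> fobj D j \<cdot> sq0 (farr D \<alpha>) = \<iota>1 j \<cdot> (sq1 (farr D \<alpha>) \<cdot> fobj D i)"
        using Comp_assoc[OF sq(5)[OF \<alpha>] Arr_hom[OF DArr[OF j]] i1(2)[OF j]] sq(7)[OF \<alpha>] by simp
      also have "\<dots> = \<iota>1 i \<cdot> fobj D i"
        using Comp_assoc[OF Arr_hom[OF DArr[OF i]] sq(6)[OF \<alpha>] i1(2)[OF j]] i1(3)[OF i j \<alpha>] by simp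
      finally show ?thesis
        by (simp add: D0)
    qed
  qed
  then obtain c where c: "c \<in> hom C a b" "\<And>i. i \<in> Obj I \<Longrightarrow> c \<cdot> \<iota>0 i = \<iota>1 i \<cdot> fobj D i"
    using is_colimit_desc[OF c0] by blast
  note cD = homD[OF c(1)]
  define \<iota> where "\<iota> i = Square (fobj D i) c (\<iota>0 i) (\<iota>1 i)" for i
  have \<iota>: "\<iota> i \<in> hom (arrow_cat C) (fobj D i) c" if "i \<in> Obj I" for i
    using that c(2) i0(2) i1(2) DArr by (simp add: \<iota>_def arrow_hom_iff cD)
  have "is_colimit I (arrow_cat C) D c \<iota>"
  proof (rule is_colimitI)
    show "cocone I (arrow_cat C) D c \<iota>"
      unfolding cocone_def using \<iota> cD sq i0(3) i1(3) by (simp add: \<iota>_def)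
    show "k = l" if k: "k \<in> hom (arrow_cat C) c g" and l: "l \<in> hom (arrow_cat C) c g"
      and eq: "\<forall>i\<in>Obj I. k \<cdot>\<^bsub>arrow_cat C\<^esub> \<iota> i = l \<cdot>\<^bsub>arrow_cat C\<^esub> \<iota> i" for g k l
    proof -
      have "sq0 k = sq0 l"
        using is_colimit_joint_epi[OF F0 c0, of "sq0 k" "Dom C g" "sq0 l"] arrow_homD[OF k]
          arrow_homD[OF l] eq by (simp add: cD \<iota>_def)
      moreover have "sq1 k = sq1 l"
        using is_colimit_joint_epi[OF F1 c1, of "sq1 k" "Cod C g" "sq1 l"] arrow_homD[OF k]
          arrow_homD[OF l] eq by (simp add: cD \<iota>_def)
      ultimately show ?thesis
        using arrow_homD[OF k] arrow_homD[OF l] by (simp add: square.expand)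
    qed
    show "\<exists>k. k \<in> hom (arrow_cat C) c g \<and> (\<forall>i\<in>Obj I. k \<cdot>\<^bsub>arrow_cat C\<^esub> \<iota> i = \<kappa> i)"
      if \<kappa>: "cocone I (arrow_cat C) D g \<kappa>" for g \<kappa>
    proof -
      have g: "g \<in> Arr C" and \<kappa>h: "\<And>i. i \<in> Obj I \<Longrightarrow> \<kappa> i \<in> hom (arrow_cat C) (fobj D i) g"
        and \<kappa>c: "\<And>i j \<alpha>. i \<in> Obj I \<Longrightarrow> j \<in> Obj I \<Longrightarrow> \<alpha> \<in> hom I i j \<Longrightarrow>
            \<kappa> j \<cdot>\<^bsub>arrow_cat C\<^esub> farr D \<alpha> = \<kappa> i"
        using \<kappa> unfolding cocone_def by simp_all
      note \<kappa>s = arrow_homD[OF \<kappa>h]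
      have \<kappa>0: "sq0 (\<kappa> j) \<cdot> sq0 (farr D \<alpha>) = sq0 (\<kappa> i)"
        and \<kappa>1: "sq1 (\<kappa> j) \<cdot> sq1 (farr D \<alpha>) = sq1 (\<kappa> i)"
        if "i \<in> Obj I" "j \<in> Obj I" "\<alpha> \<in> hom I i j" for i j \<alpha>
        using \<kappa>c[OF that] by (metis arrow_cat_simps(5) square.sel(3,4))+
      have "cocone I C D0 (Dom C g) (\<lambda>i. sq0 (\<kappa> i))"
        unfolding cocone_def D0 using \<kappa>s \<kappa>0 g Dom_in_Obj by simp
      then obtain k0 where k0: "k0 \<in> hom C a (Dom C g)" "\<And>i. i \<in> Obj I \<Longrightarrow> k0 \<cdot> \<iota>0 i = sq0 (\<kappa> i)"
        using is_colimit_desc[OF c0] by blast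
      have "cocone I C D1 (Cod C g) (\<lambda>i. sq1 (\<kappa> i))"
        unfolding cocone_def D1 using \<kappa>s \<kappa>1 g Cod_in_Obj by simp
      then obtain k1 where k1: "k1 \<in> hom C b (Cod C g)" "\<And>i. i \<in> Obj I \<Longrightarrow> k1 \<cdot> \<iota>1 i = sq1 (\<kappa> i)"
        using is_colimit_desc[OF c1] by blast
      \<comment> \<open>The components \<open>k0\<close> and \<open>k1\<close> were induced
        independently. That they form a square is tested on the coprojections of the domain colimit,
        where it reduces to the commutativity of each \<open>\<kappa> i\<close>.\<close>
      have "g \<cdot> k0 = k1 \<cdot> c"
      proof (rule is_colimit_joint_epi[OF F0 c0])
        show "g \<cdot> k0 \<in> hom C a (Cod C g)" "k1 \<cdot> c \<in> hom C a (Cod C g)"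
          using Comp_in_hom k0(1) k1(1) c(1) Arr_hom[OF g] by blast+
        show "g \<cdot> k0 \<cdot> \<iota>0 i = k1 \<cdot> c \<cdot> \<iota>0 i" if i: "i \<in> Obj I" for i
          using Comp_assoc[OF i0(2)[OF i] k0(1) Arr_hom[OF g]] Comp_assoc[OF i0(2)[OF i] c(1) k1(1)]
            Comp_assoc[OF Arr_hom[OF DArr[OF i]] i1(2)[OF i] k1(1)] k0(2)[OF i] k1(2)[OF i] c(2)[OF i]
            \<kappa>s(7)[OF i]
          by simp
      qed
      then have "Square c g k0 k1 \<in> hom (arrow_cat C) c g"
        using k0 k1 cD g by (simp add: arrow_hom_iff)
      moreover have "\<forall>i\<in>Obj I. Square c g k0 k1 \<cdot>\<^bsub>arrow_cat C\<^esub> \<iota> i = \<kappa> i"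
        using k0(2) k1(2) \<kappa>s by (auto simp: \<iota>_def intro: square.expand)
      ultimately show ?thesis
        by blast
    qed
  qed
  then show "\<exists>c \<iota>. is_colimit I (arrow_cat C) D c \<iota>"
    by blast
qed

text \<open>A pushout is the colimit of a span, and the span shape is finite, hence small for an
  infinite \<open>\<Omega>\<close>.\<close>

lemma (in category) cocomplete_pushout:
  assumes \<Omega>: "size_cardinal \<Omega>" and cc: "cocomplete \<Omega> C"
    and h: "h \<in> hom C a b" and k: "k \<in> hom C a c"
  shows "\<exists>p q. is_pushout C h k p q"
proof -
  \<comment> \<open>The shape \<open>1 <- 0 -> 2\<close> as an ordered set: an arrow is the pair of
    its ends, so composition merely forgets the middle.\<close>
  define S :: "(nat, nat \<times> nat) cat" where
    "S = \<lparr>Obj = {0, 1, 2}, Arr = {(i, j) \<in> {0, 1, 2} \<times> {0, 1, 2}. i = j \<or> i = 0}, Dom = fst, Cod = snd,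
       Id = \<lambda>i. (i, i), Comp = \<lambda>y x. (fst x, snd y)\<rparr>"
  define X where "X i = (if i = (0::nat) then a else if i = 1 then b else c)" for i
  define D where "D = \<lparr>fobj = X, farr = \<lambda>x :: nat \<times> nat. if x = (0,1) then h else if x = (0,2) then k else Id C (X (fst x))\<rparr>"
  have homS: "x \<in> hom S i j \<longleftrightarrow> x = (i, j) \<and> i \<in> Obj S \<and> j \<in> Obj S \<and> (i = j \<or> i = 0)" for x i j
    unfolding hom_def S_def by (cases x) auto
  have ObjS: "Obj S = {0, 1, 2}" and S_simps: "Dom S = fst" "Cod S = snd" "Id S i = (i, i)"
    "y \<cdot>\<^bsub>S\<^esub> x = (fst x, snd y)" "Arr S = {(i, j). i \<in> Obj S \<and> j \<in> Obj S \<and> (i = j \<or> i = 0)}" for i x y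
    by (auto simp: S_def)
  have "category S"
    by unfold_locales (auto simp only: homS S_simps fst_conv snd_conv)
  have abc: "a \<in> Obj C" "b \<in> Obj C" "c \<in> Obj C"
    using h k hom_Obj by blast+
  have D_simps: "fobj D 0 = a" "fobj D 1 = b" "fobj D 2 = c" "farr D (0, 1) = h" "farr D (0, 2) = k"
    "farr D (i, i) = Id C (fobj D i)" for i
    by (auto simp: D_def X_def)
  have farr_D: "farr D x \<in> hom C (fobj D i) (fobj D j)" if "x \<in> hom S i j" for x i j
    using that abc h k Id_in_hom by (auto simp: D_def X_def homS ObjS)
  have SD: "is_functor S C D"
  proof (intro is_functor.intro is_functor_axioms.intro \<open>category S\<close> category_axioms)
    show "fobj D i \<in> Obj C" if "i \<in> Obj S" for i
      using abc by (simp add: D_def X_def)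
    show "farr D x \<in> hom C (fobj D i) (fobj D j)" if "x \<in> hom S i j" for x i j
      using that by (rule farr_D)
    show "farr D (Id S i) = Id C (fobj D i)" if "i \<in> Obj S" for i
      by (simp add: S_simps D_simps)
    show "farr D (y \<cdot>\<^bsub>S\<^esub> x) = farr D y \<cdot> farr D x" if "x \<in> hom S i j" "y \<in> hom S j l" for x y i j l
    proof -
      \<comment> \<open>No two non-identity arrows of the span compose, so only the unit laws are at
        stake.\<close>
      have "i = j \<or> j = l"
        using that by (auto simp: homS)
      then show ?thesis
      proof
        assume "i = j"
        then show ?thesis
          using that Comp_Id[OF farr_D[OF that(2)]] by (auto simp: homS S_simps D_simps)
      next
        assume "j = l"
        then show ?thesis
          using that Id_Comp[OF farr_D[OF that(1)]] by (auto simp: homS S_simps D_simps)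
      qed
    qed
  qed
  have "small_cat \<Omega> S"
    unfolding small_cat_def
  proof (intro conjI small_finite[OF \<Omega>])
    show "finite (Obj S)"
      by (simp add: ObjS)
    moreover have "Arr S \<subseteq> Obj S \<times> Obj S"
      by (auto simp only: S_simps)
    ultimately show "finite (Arr S)"
      by (simp add: finite_subset)
  qed
  from cocomplete_colimit[OF \<Omega> cc this SD] obtain s \<iota> where col: "is_colimit S C D s \<iota>"
    by blast
  \<comment> \<open>The leg at \<open>0\<close> is determined by either of the other two, so a
    cocone on the span is a commuting square.\<close>
  have cocone_iff: "cocone S C D t \<kappa> \<longleftrightarrow> \<kappa> 0 \<in> hom C a t \<and> \<kappa> 1 \<in> hom C b t \<and> \<kappa> 2 \<in> hom C c t \<and>
      \<kappa> 1 \<cdot> h = \<kappa> 0 \<and> \<kappa> 2 \<cdot> k = \<kappa> 0" (is "?L \<longleftrightarrow> ?R") for t \<kappa>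
  proof
    assume ?L
    then have *: "i \<in> Obj S \<Longrightarrow> \<kappa> i \<in> hom C (fobj D i) t"
      "i \<in> Obj S \<Longrightarrow> j \<in> Obj S \<Longrightarrow> x \<in> hom S i j \<Longrightarrow> \<kappa> j \<cdot> farr D x = \<kappa> i" for i j x
      unfolding cocone_def by blast+
    show ?R
      using *(1)[of 0] *(1)[of 1] *(1)[of 2] *(2)[of 0 1 "(0, 1)"] *(2)[of 0 2 "(0, 2)"]
      unfolding homS D_simps by (simp only: ObjS) simp
  next
    assume R: ?R
    have \<kappa>: "\<kappa> i \<in> hom C (fobj D i) t" if "i \<in> Obj S" for i
      using that R unfolding ObjS by (elim insertE emptyE) (simp_all only: D_simps)
    have "\<kappa> j \<cdot> farr D x = \<kappa> i" if "x \<in> hom S i j" for i j x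
    proof (cases "i = j")
      case True
      then show ?thesis
        using that Comp_Id[OF \<kappa>] by (simp add: homS D_simps)
    next
      case False
      then have "x = (0, 1) \<and> i = 0 \<and> j = 1 \<or> x = (0, 2) \<and> i = 0 \<and> j = 2"
        using that by (auto simp: homS ObjS)
      then show ?thesis
        using R by (elim disjE conjE) (simp_all only: D_simps)
    qed
    moreover have "t \<in> Obj C"
      using R hom_Obj by blast
    ultimately show ?L
      using \<kappa> unfolding cocone_def by blast
  qed
  have \<iota>: "\<iota> 0 \<in> hom C a s" "\<iota> 1 \<in> hom C b s" "\<iota> 2 \<in> hom C c s" "\<iota> 1 \<cdot> h = \<iota> 0" "\<iota> 2 \<cdot> k = \<iota> 0"
    using col by (simp_all add: is_colimit_def cocone_iff)
  have univ: "\<exists>!m. m \<in> hom C s t \<and> m \<cdot> \<iota> 2 = p' \<and> m \<cdot> \<iota> 1 = q'"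
    if *: "p' \<in> hom C c t" "q' \<in> hom C b t" "p' \<cdot> k = q' \<cdot> h" for t p' q'
  proof -
    define \<kappa> where "\<kappa> i = (if i = (0::nat) then q' \<cdot> h else if i = 1 then q' else p')" for i
    have "cocone S C D t \<kappa>"
      using * Comp_in_hom[OF h] by (simp add: cocone_iff \<kappa>_def)
    then have ex: "\<exists>!m. m \<in> hom C s t \<and> (\<forall>i\<in>Obj S. m \<cdot> \<iota> i = \<kappa> i)"
      using col unfolding is_colimit_def by blast
    have "m \<in> hom C s t \<and> (\<forall>i\<in>Obj S. m \<cdot> \<iota> i = \<kappa> i) \<longleftrightarrow>
        m \<in> hom C s t \<and> m \<cdot> \<iota> 2 = p' \<and> m \<cdot> \<iota> 1 = q'" for m
      using Comp_assoc[OF h \<iota>(2), of m t] \<iota>(4) by (auto simp: ObjS \<kappa>_def)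
    then show ?thesis
      using ex by (simp only:)
  qed
  note cods = homD[OF h] homD[OF k] homD(3)[OF \<iota>(3)]
  \<comment> \<open>\<open>is_pushout\<close> lists first the coprojection that follows
    \<open>k\<close>, and \<open>k\<close> leads to the object \<open>2\<close>; hence the leg at
    \<open>2\<close> precedes the leg at \<open>1\<close>.\<close>
  have "is_pushout C h k (\<iota> 2) (\<iota> 1)"
    unfolding is_pushout_def cods using cods(1,4) \<iota> univ by metis
  then show ?thesis
    by blast
qed

subsection \<open>The universal property of \<open>Tf\<close>\<close>

text \<open>All questions of size are confined to the two existence assumptions, which give the
  \<open>SOME\<close> choices their meaning. The arrow \<open>f\<close> is fixed because naturality
  is in \<open>g\<close> alone.\<close>

locale one_step_setting = C: category C + U: is_functor J "arrow_cat C" U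
  for C :: "('o, 'm) cat" and J :: "('j, 'a) cat" and U :: "('j, 'a, 'm, 'm square) ftor" +
  fixes f :: 'm
  assumes f_Arr: "f \<in> Arr C"
    and colimit_ex: "\<exists>c \<iota>. is_colimit (comma J (arrow_cat C) U f) (arrow_cat C) (comma_diagram U) c \<iota>"
    and pushout_ex: "\<lbrakk>h \<in> hom C a b; k \<in> hom C a c\<rbrakk> \<Longrightarrow> \<exists>p q. is_pushout C h k p q"
begin

abbreviation C2 where "C2 \<equiv> arrow_cat C"
abbreviation Cf where "Cf \<equiv> C_of J C U f"
abbreviation \<iota> where "\<iota> \<equiv> C_coproj J C U f"
abbreviation \<epsilon> where "\<epsilon> \<equiv> eps J C U f"
abbreviation K where "K \<equiv> K_of J C U f"
abbreviation q where "q \<equiv> q_of J C U f"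
abbreviation S where "S \<equiv> S_of J C U f"
abbreviation T where "T \<equiv> T_of J C U f"

lemma f_hom: "f \<in> hom C (Dom C f) (Cod C f)"
  by (rule C.Arr_hom[OF f_Arr])

section \<open>The colimit \<open>Cf\<close> and its map \<open>\<epsilon>\<close> to
  \<open>f\<close>\<close>

lemma colimit: "is_colimit (comma J C2 U f) C2 (comma_diagram U) Cf \<iota>"
  using someI_ex[of "\<lambda>(c, \<iota>). is_colimit (comma J C2 U f) C2 (comma_diagram U) c \<iota>"] colimit_ex
  by (simp add: C_of_def C_coproj_def density_colimit_def case_prod_unfold)

text \<open>A comma arrow into \<open>(j, \<sigma>)\<close> is given by \<open>\<alpha>\<close>
  alone, its source being forced to be \<open>\<sigma>\<close> composed with
  \<open>farr U \<alpha>\<close>. Eliminating the source puts the cocone law into the shape of the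
  compatibility condition in \<open>one_step\<close>.\<close>

lemma cocone_iff:
  "cocone (comma J C2 U f) C2 (comma_diagram U) g \<kappa> \<longleftrightarrow> g \<in> Arr C \<and>
     (\<forall>j\<in>Obj J. \<forall>\<sigma>\<in>hom C2 (fobj U j) f. \<kappa> (j, \<sigma>) \<in> hom C2 (fobj U j) g) \<and>
     (\<forall>i\<in>Obj J. \<forall>j\<in>Obj J. \<forall>\<alpha>\<in>hom J i j. \<forall>\<sigma>\<in>hom C2 (fobj U j) f.
        \<kappa> (j, \<sigma>) \<cdot>\<^bsub>C2\<^esub> farr U \<alpha> = \<kappa> (i, \<sigma> \<cdot>\<^bsub>C2\<^esub> farr U \<alpha>))"
  (is "?cocone \<longleftrightarrow> ?R")
proof
  let ?X = "comma J C2 U f"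
  have D: "fobj (comma_diagram U) (j, \<sigma>) = fobj U j" "farr (comma_diagram U) (x, \<alpha>, y) = farr U \<alpha>"
    for j x y and \<sigma> :: "'m square" and \<alpha>
    by (simp_all add: comma_diagram_def)
  show ?R if ?cocone
  proof (intro conjI ballI)
    show "g \<in> Arr C"
      using that by (simp add: cocone_def)
    show "\<kappa> (j, \<sigma>) \<in> hom C2 (fobj U j) g" if "j \<in> Obj J" "\<sigma> \<in> hom C2 (fobj U j) f" for j \<sigma>
      using \<open>?cocone\<close> that D(1)[of j \<sigma>] unfolding cocone_def by fastforce
    show "\<kappa> (j, \<sigma>) \<cdot>\<^bsub>C2\<^esub> farr U \<alpha> = \<kappa> (i, \<sigma> \<cdot>\<^bsub>C2\<^esub> farr U \<alpha>)"
      if ij: "i \<in> Obj J" "j \<in> Obj J" and \<alpha>: "\<alpha> \<in> hom J i j" and \<sigma>: "\<sigma> \<in> hom C2 (fobj U j) f" for i j \<alpha> \<sigma>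
    proof -
      let ?x = "(i, \<sigma> \<cdot>\<^bsub>C2\<^esub> farr U \<alpha>)"
      have "\<sigma> \<cdot>\<^bsub>C2\<^esub> farr U \<alpha> \<in> hom C2 (fobj U i) f"
        using U.B.Comp_in_hom[OF U.farr_in_hom[OF \<alpha>] \<sigma>] .
      then have "?x \<in> Obj ?X" "(j, \<sigma>) \<in> Obj ?X" "(?x, \<alpha>, (j, \<sigma>)) \<in> hom ?X ?x (j, \<sigma>)"
        using ij \<alpha> \<sigma> by (simp_all add: U.comma_hom_iff del: arrow_cat_simps(5))
      then have "\<kappa> (j, \<sigma>) \<cdot>\<^bsub>C2\<^esub> farr (comma_diagram U) (?x, \<alpha>, (j, \<sigma>)) = \<kappa> ?x"
        using \<open>?cocone\<close> unfolding cocone_def by blast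
      then show ?thesis
        by (simp only: D)
    qed
  qed
  show ?cocone if ?R
    unfolding cocone_def
  proof (intro conjI ballI)
    show "\<kappa> x \<in> hom C2 (fobj (comma_diagram U) x) g" if "x \<in> Obj ?X" for x
      using that \<open>?R\<close> by (auto simp: D)
    show "\<kappa> y \<cdot>\<^bsub>C2\<^esub> farr (comma_diagram U) s = \<kappa> x" if "s \<in> hom ?X x y" for x y s
      using that \<open>?R\<close> by (cases x; cases y) (auto simp: U.comma_hom_iff D simp del: arrow_cat_simps(5))
    show "g \<in> Obj C2"
      using \<open>?R\<close> by simp
  qed
qed

lemma cocone_\<iota>: "cocone (comma J C2 U f) C2 (comma_diagram U) Cf \<iota>"
  using colimit by (simp add: is_colimit_def)

lemma Cf_Arr: "Cf \<in> Arr C"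
  and \<iota>_hom: "\<lbrakk>j \<in> Obj J; \<sigma> \<in> hom C2 (fobj U j) f\<rbrakk> \<Longrightarrow> \<iota> (j, \<sigma>) \<in> hom C2 (fobj U j) Cf"
  and \<iota>_Comp: "\<lbrakk>i \<in> Obj J; j \<in> Obj J; \<alpha> \<in> hom J i j; \<sigma> \<in> hom C2 (fobj U j) f\<rbrakk> \<Longrightarrow>
    \<iota> (j, \<sigma>) \<cdot>\<^bsub>C2\<^esub> farr U \<alpha> = \<iota> (i, \<sigma> \<cdot>\<^bsub>C2\<^esub> farr U \<alpha>)"
  using cocone_\<iota> unfolding cocone_iff by blast+

lemma \<epsilon>_hom: "\<epsilon> \<in> hom C2 Cf f"
  and \<epsilon>_\<iota>: "\<lbrakk>j \<in> Obj J; \<sigma> \<in> hom C2 (fobj U j) f\<rbrakk> \<Longrightarrow> \<epsilon> \<cdot>\<^bsub>C2\<^esub> \<iota> (j, \<sigma>) = \<sigma>"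
proof -
  \<comment> \<open>An object of the comma category is a pair \<open>(j, \<sigma>)\<close>, so the
    tautological cocone with vertex \<open>f\<close> is \<open>snd\<close>.\<close>
  have "cocone (comma J C2 U f) C2 (comma_diagram U) f snd"
    using f_Arr by (simp add: cocone_iff)
  then have "\<exists>!e. e \<in> hom C2 Cf f \<and> (\<forall>x\<in>Obj (comma J C2 U f). e \<cdot>\<^bsub>C2\<^esub> \<iota> x = snd x)"
    using colimit unfolding is_colimit_def by blast
  then have "\<exists>!e. e \<in> hom C2 Cf f \<and> (\<forall>(j, \<sigma>)\<in>Obj (comma J C2 U f). e \<cdot>\<^bsub>C2\<^esub> \<iota> (j, \<sigma>) = \<sigma>)"
    by (simp add: case_prod_unfold)
  from theI'[OF this] show "\<epsilon> \<in> hom C2 Cf f"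
    and "\<lbrakk>j \<in> Obj J; \<sigma> \<in> hom C2 (fobj U j) f\<rbrakk> \<Longrightarrow> \<epsilon> \<cdot>\<^bsub>C2\<^esub> \<iota> (j, \<sigma>) = \<sigma>"
    unfolding eps_def[symmetric] by auto
qed

lemmas \<epsilon>D = arrow_homD[OF \<epsilon>_hom]
  and \<iota>D = arrow_homD[OF \<iota>_hom]

lemma \<epsilon>0_\<iota>0: "\<lbrakk>j \<in> Obj J; \<sigma> \<in> hom C2 (fobj U j) f\<rbrakk> \<Longrightarrow> sq0 \<epsilon> \<cdot>\<^bsub>C\<^esub> sq0 (\<iota> (j, \<sigma>)) = sq0 \<sigma>"
  and \<epsilon>1_\<iota>1: "\<lbrakk>j \<in> Obj J; \<sigma> \<in> hom C2 (fobj U j) f\<rbrakk> \<Longrightarrow> sq1 \<epsilon> \<cdot>\<^bsub>C\<^esub> sq1 (\<iota> (j, \<sigma>)) = sq1 \<sigma>"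
  using \<epsilon>_\<iota> by (metis arrow_cat_simps(5) square.sel(3,4))+

text \<open>A map \<open>k\<close> out of the codomain of \<open>Cf\<close> is the same as a square from \<open>Cf\<close> to an identity.\<close>

lemma Cod_Cf_joint_epi:
  assumes k: "k \<in> hom C (Cod C Cf) a" and l: "l \<in> hom C (Cod C Cf) a"
    and eq: "\<And>j \<sigma>. \<lbrakk>j \<in> Obj J; \<sigma> \<in> hom C2 (fobj U j) f\<rbrakk> \<Longrightarrow>
      k \<cdot>\<^bsub>C\<^esub> sq1 (\<iota> (j, \<sigma>)) = l \<cdot>\<^bsub>C\<^esub> sq1 (\<iota> (j, \<sigma>))"
  shows "k = l"
proof -
  let ?i = "Id C a"
  have a: "a \<in> Obj C"
    using k C.hom_Obj by blast
  note i = homD[OF C.Id_in_hom[OF a]]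
  have Sq: "Square Cf ?i (m \<cdot>\<^bsub>C\<^esub> Cf) m \<in> hom C2 Cf ?i" if m: "m \<in> hom C (Cod C Cf) a" for m
    using C.Comp_in_hom[OF C.Arr_hom[OF Cf_Arr] m] m Cf_Arr i C.Id_Comp by (simp add: arrow_hom_iff)
  have "Square Cf ?i (k \<cdot>\<^bsub>C\<^esub> Cf) k = Square Cf ?i (l \<cdot>\<^bsub>C\<^esub> Cf) l"
  proof (rule U.B.is_colimit_joint_epi[OF U.is_functor_comma_diagram colimit Sq[OF k] Sq[OF l]])
    fix x
    assume "x \<in> Obj (comma J C2 U f)"
    then obtain j \<sigma> where x: "x = (j, \<sigma>)" and j: "j \<in> Obj J" "\<sigma> \<in> hom C2 (fobj U j) f"
      by auto
    \<comment> \<open>Only the codomain parts are assumed to agree; since \<open>\<iota> x\<close>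
      is a commutative square, they determine the domain parts.\<close>
    have "m \<cdot>\<^bsub>C\<^esub> Cf \<cdot>\<^bsub>C\<^esub> sq0 (\<iota> x) = m \<cdot>\<^bsub>C\<^esub> sq1 (\<iota> x) \<cdot>\<^bsub>C\<^esub> fobj U j"
      if m: "m \<in> hom C (Cod C Cf) a" for m
      using C.Comp_assoc[OF \<iota>D(5)[OF j] C.Arr_hom[OF Cf_Arr] m]
        C.Comp_assoc[OF C.Arr_hom[OF \<iota>D(1)[OF j]] \<iota>D(6)[OF j] m] \<iota>D(7)[OF j]
      by (simp add: x)
    then show "Square Cf ?i (k \<cdot>\<^bsub>C\<^esub> Cf) k \<cdot>\<^bsub>C2\<^esub> \<iota> x = Square Cf ?i (l \<cdot>\<^bsub>C\<^esub> Cf) l \<cdot>\<^bsub>C2\<^esub> \<iota> x"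
      using k l eq[OF j] by (simp add: x)
  qed
  then show ?thesis
    by simp
qed

section \<open>The pushout \<open>S\<close> and the map \<open>T\<close>\<close>

lemma pushout: "is_pushout C Cf (sq0 \<epsilon>) K q"
proof -
  have "\<exists>p q. is_pushout C Cf (sq0 \<epsilon>) p q"
    using pushout_ex[OF C.Arr_hom[OF Cf_Arr] \<epsilon>D(5)] .
  then show ?thesis
    using someI_ex[of "\<lambda>(p, q). is_pushout C Cf (sq0 \<epsilon>) p q"]
    by (simp add: K_of_def q_of_def S_pushout_def case_prod_unfold)
qed

lemma K_hom: "K \<in> hom C (Dom C f) S"
  and q_hom: "q \<in> hom C (Cod C Cf) S"
  and K_\<epsilon>: "K \<cdot>\<^bsub>C\<^esub> sq0 \<epsilon> = q \<cdot>\<^bsub>C\<^esub> Cf"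
  using pushout homD[OF \<epsilon>D(5)] by (simp_all add: is_pushout_def S_of_def)

lemma pushout_desc:
  assumes "p' \<in> hom C (Dom C f) a" "q' \<in> hom C (Cod C Cf) a" "p' \<cdot>\<^bsub>C\<^esub> sq0 \<epsilon> = q' \<cdot>\<^bsub>C\<^esub> Cf"
  shows "\<exists>!t. t \<in> hom C S a \<and> t \<cdot>\<^bsub>C\<^esub> K = p' \<and> t \<cdot>\<^bsub>C\<^esub> q = q'"
  using pushout assms homD[OF \<epsilon>D(5)] by (simp add: is_pushout_def S_of_def)

lemma pushout_joint_epi:
  assumes s: "s \<in> hom C S a" and t: "t \<in> hom C S a"
    and "s \<cdot>\<^bsub>C\<^esub> K = t \<cdot>\<^bsub>C\<^esub> K" "s \<cdot>\<^bsub>C\<^esub> q = t \<cdot>\<^bsub>C\<^esub> q"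
  shows "s = t"
proof -
  have "t \<cdot>\<^bsub>C\<^esub> K \<cdot>\<^bsub>C\<^esub> sq0 \<epsilon> = t \<cdot>\<^bsub>C\<^esub> q \<cdot>\<^bsub>C\<^esub> Cf"
    using C.Comp_assoc[OF \<epsilon>D(5) K_hom t] C.Comp_assoc[OF C.Arr_hom[OF Cf_Arr] q_hom t] K_\<epsilon> by simp
  from pushout_desc[OF C.Comp_in_hom[OF K_hom t] C.Comp_in_hom[OF q_hom t] this]
  show ?thesis
    using assms by metis
qed

lemma T_hom: "T \<in> hom C S (Cod C f)"
  and T_K: "T \<cdot>\<^bsub>C\<^esub> K = f"
  and T_q: "T \<cdot>\<^bsub>C\<^esub> q = sq1 \<epsilon>"
proof -
  have "\<exists>!t. t \<in> hom C S (Cod C f) \<and> t \<cdot>\<^bsub>C\<^esub> K = f \<and> t \<cdot>\<^bsub>C\<^esub> q = sq1 \<epsilon>"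
    \<comment> \<open>The compatibility that the pushout demands is the commutativity of the square
      \<open>\<epsilon>\<close>.\<close>
    by (rule pushout_desc[OF f_hom \<epsilon>D(6,7)])
  from theI'[OF this] show "T \<in> hom C S (Cod C f)" "T \<cdot>\<^bsub>C\<^esub> K = f" "T \<cdot>\<^bsub>C\<^esub> q = sq1 \<epsilon>"
    unfolding T_of_def[symmetric] by auto
qed

section \<open>The bijection \<open>kappa\<close> and its naturality\<close>

text \<open>The target \<open>g\<close> is recovered from the square itself, so a single function
  serves all \<open>g\<close>. The restriction matches the convention that lifting families are
  \<open>undefined\<close> off their domain.\<close>

definition kappa :: "'m square \<Rightarrow> 'm square \<times> ('j \<times> 'm square \<Rightarrow> 'm)" where
  "kappa h =
     (Square f (sq_tgt h) (sq0 h \<cdot>\<^bsub>C\<^esub> K) (sq1 h),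
      restrict (\<lambda>x. sq0 h \<cdot>\<^bsub>C\<^esub> q \<cdot>\<^bsub>C\<^esub> sq1 (\<iota> x)) (lifting_dom J C U f))"

lemma T_square_homD:
  assumes "h \<in> hom C2 T g"
  shows "g \<in> Arr C" "sq_src h = T" "sq_tgt h = g" "sq0 h \<in> hom C S (Dom C g)"
    "sq1 h \<in> hom C (Cod C f) (Cod C g)" "g \<cdot>\<^bsub>C\<^esub> sq0 h = sq1 h \<cdot>\<^bsub>C\<^esub> T"
  using arrow_homD[OF assms] homD[OF T_hom] by simp_all

text \<open>Each condition has its own source: the square \<open>u\<close> commutes by
  \<open>T_K\<close>, the upper triangle of a lift rests on the gluing \<open>K_\<epsilon>\<close>,
  the lower one on \<open>T_q\<close>, and compatibility with \<open>\<alpha>\<close> on the cocone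
  law of \<open>\<iota>\<close>.\<close>

lemma kappa_in_one_step:
  assumes h: "h \<in> hom C2 T g"
  shows "kappa h \<in> one_step J C U f g"
proof -
  note hD = T_square_homD[OF h]
  note q1 = C.Comp_in_hom[OF q_hom hD(4)]
  have g: "g \<in> hom C (Dom C g) (Cod C g)"
    using hD(1) by (rule C.Arr_hom)
  have "g \<cdot>\<^bsub>C\<^esub> (sq0 h \<cdot>\<^bsub>C\<^esub> K) = sq1 h \<cdot>\<^bsub>C\<^esub> f"
    using C.Comp_assoc[OF K_hom hD(4) g] C.Comp_assoc[OF K_hom T_hom hD(5)] hD(6) T_K by simp
  then have "Square f g (sq0 h \<cdot>\<^bsub>C\<^esub> K) (sq1 h) \<in> hom C2 f g"
    using f_Arr hD C.Comp_in_hom[OF K_hom hD(4)] by (simp add: arrow_hom_iff)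
  moreover have "sq0 h \<cdot>\<^bsub>C\<^esub> q \<cdot>\<^bsub>C\<^esub> sq1 (\<iota> (j, \<sigma>)) \<in> hom C (Cod C (fobj U j)) (Dom C g)
      \<and> sq0 h \<cdot>\<^bsub>C\<^esub> q \<cdot>\<^bsub>C\<^esub> sq1 (\<iota> (j, \<sigma>)) \<cdot>\<^bsub>C\<^esub> fobj U j = sq0 h \<cdot>\<^bsub>C\<^esub> K \<cdot>\<^bsub>C\<^esub> sq0 \<sigma>
      \<and> g \<cdot>\<^bsub>C\<^esub> (sq0 h \<cdot>\<^bsub>C\<^esub> q \<cdot>\<^bsub>C\<^esub> sq1 (\<iota> (j, \<sigma>))) = sq1 h \<cdot>\<^bsub>C\<^esub> sq1 \<sigma>"
    if j: "j \<in> Obj J" "\<sigma> \<in> hom C2 (fobj U j) f" for j \<sigma>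
  proof (intro conjI)
    note jD = \<iota>D[OF j]
    show "sq0 h \<cdot>\<^bsub>C\<^esub> q \<cdot>\<^bsub>C\<^esub> sq1 (\<iota> (j, \<sigma>)) \<in> hom C (Cod C (fobj U j)) (Dom C g)"
      by (rule C.Comp_in_hom[OF jD(6) q1])
    have "sq0 h \<cdot>\<^bsub>C\<^esub> q \<cdot>\<^bsub>C\<^esub> sq1 (\<iota> (j, \<sigma>)) \<cdot>\<^bsub>C\<^esub> fobj U j = sq0 h \<cdot>\<^bsub>C\<^esub> q \<cdot>\<^bsub>C\<^esub> (Cf \<cdot>\<^bsub>C\<^esub> sq0 (\<iota> (j, \<sigma>)))"
      using C.Comp_assoc[OF C.Arr_hom[OF jD(1)] jD(6) q1] jD(7) by simp
    also have "\<dots> = sq0 h \<cdot>\<^bsub>C\<^esub> (q \<cdot>\<^bsub>C\<^esub> Cf) \<cdot>\<^bsub>C\<^esub> sq0 (\<iota> (j, \<sigma>))"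
      using C.Comp_assoc[OF jD(5) C.Arr_hom[OF Cf_Arr] q1]
        C.Comp_assoc[OF C.Arr_hom[OF Cf_Arr] q_hom hD(4)] by simp
    also have "\<dots> = sq0 h \<cdot>\<^bsub>C\<^esub> K \<cdot>\<^bsub>C\<^esub> sq0 \<sigma>"
      using C.Comp_assoc[OF \<epsilon>D(5) K_hom hD(4)]
        C.Comp_assoc[OF jD(5) \<epsilon>D(5) C.Comp_in_hom[OF K_hom hD(4)]] \<epsilon>0_\<iota>0[OF j] K_\<epsilon> by simp
    finally show "sq0 h \<cdot>\<^bsub>C\<^esub> q \<cdot>\<^bsub>C\<^esub> sq1 (\<iota> (j, \<sigma>)) \<cdot>\<^bsub>C\<^esub> fobj U j = sq0 h \<cdot>\<^bsub>C\<^esub> K \<cdot>\<^bsub>C\<^esub> sq0 \<sigma>" .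
    have "g \<cdot>\<^bsub>C\<^esub> (sq0 h \<cdot>\<^bsub>C\<^esub> q) = sq1 h \<cdot>\<^bsub>C\<^esub> sq1 \<epsilon>"
      using C.Comp_assoc[OF q_hom hD(4) g] C.Comp_assoc[OF q_hom T_hom hD(5)] hD(6) T_q by simp
    then show "g \<cdot>\<^bsub>C\<^esub> (sq0 h \<cdot>\<^bsub>C\<^esub> q \<cdot>\<^bsub>C\<^esub> sq1 (\<iota> (j, \<sigma>))) = sq1 h \<cdot>\<^bsub>C\<^esub> sq1 \<sigma>"
      using C.Comp_assoc[OF jD(6) q1 g] C.Comp_assoc[OF jD(6) \<epsilon>D(6) hD(5)] \<epsilon>1_\<iota>1[OF j] by simp
  qed
  moreover have "sq0 h \<cdot>\<^bsub>C\<^esub> q \<cdot>\<^bsub>C\<^esub> sq1 (\<iota> (i, \<sigma> \<cdot>\<^bsub>C2\<^esub> farr U \<alpha>)) =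
      sq0 h \<cdot>\<^bsub>C\<^esub> q \<cdot>\<^bsub>C\<^esub> sq1 (\<iota> (j, \<sigma>)) \<cdot>\<^bsub>C\<^esub> sq1 (farr U \<alpha>)"
    if "i \<in> Obj J" "j \<in> Obj J" "\<alpha> \<in> hom J i j" "\<sigma> \<in> hom C2 (fobj U j) f" for i j \<alpha> \<sigma>
    using C.Comp_assoc[OF arrow_homD(6)[OF U.farr_in_hom[OF that(3)]] \<iota>D(6)[OF that(2,4)] q1]
      \<iota>_Comp[OF that, symmetric] by simp
  moreover have "\<sigma> \<cdot>\<^bsub>C2\<^esub> farr U \<alpha> \<in> hom C2 (fobj U i) f"
    if "\<alpha> \<in> hom J i j" "\<sigma> \<in> hom C2 (fobj U j) f" for i j \<alpha> \<sigma>
    using that U.farr_in_hom U.B.Comp_in_hom by blast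
  ultimately show ?thesis
    by (simp add: one_step_def kappa_def hD lifting_dom_def del: arrow_cat_simps(5))
qed

text \<open>\<open>kappa h\<close> records \<open>sq1 h\<close> outright, while \<open>sq0 h\<close>
  is determined by its composites with \<open>K\<close> and \<open>q\<close>, the latter being
  detected on the coprojections of \<open>Cf\<close>.\<close>

lemma kappa_inj:
  assumes h: "h \<in> hom C2 T g" and l: "l \<in> hom C2 T g" and eq: "kappa h = kappa l"
  shows "h = l"
proof -
  note hD = T_square_homD[OF h] and lD = T_square_homD[OF l]
  have "sq0 h \<cdot>\<^bsub>C\<^esub> K = sq0 l \<cdot>\<^bsub>C\<^esub> K" and s1: "sq1 h = sq1 l"
    and *: "restrict (\<lambda>x. sq0 h \<cdot>\<^bsub>C\<^esub> q \<cdot>\<^bsub>C\<^esub> sq1 (\<iota> x)) (lifting_dom J C U f) =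
      restrict (\<lambda>x. sq0 l \<cdot>\<^bsub>C\<^esub> q \<cdot>\<^bsub>C\<^esub> sq1 (\<iota> x)) (lifting_dom J C U f)"
    using eq by (simp_all add: kappa_def)
  moreover have "sq0 h \<cdot>\<^bsub>C\<^esub> q \<cdot>\<^bsub>C\<^esub> sq1 (\<iota> (j, \<sigma>)) = sq0 l \<cdot>\<^bsub>C\<^esub> q \<cdot>\<^bsub>C\<^esub> sq1 (\<iota> (j, \<sigma>))"
    if "j \<in> Obj J" "\<sigma> \<in> hom C2 (fobj U j) f" for j \<sigma>
    using fun_cong[OF *, of "(j, \<sigma>)"] that by (simp add: lifting_dom_def)
  then have "sq0 h \<cdot>\<^bsub>C\<^esub> q = sq0 l \<cdot>\<^bsub>C\<^esub> q"
    using Cod_Cf_joint_epi[OF C.Comp_in_hom[OF q_hom hD(4)] C.Comp_in_hom[OF q_hom lD(4)]] by blast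
  ultimately have "sq0 h = sq0 l"
    using pushout_joint_epi[OF hD(4) lD(4)] by blast
  then show ?thesis
    using s1 hD lD by (simp add: square.expand)
qed

text \<open>The pairs \<open>(u\<^sub>0 \<circ> \<sigma>\<^sub>0, \<phi>\<^sub>j \<sigma>)\<close> form a cocone with vertex the identity of \<open>Dom g\<close>; composing it
  with the square \<open>(1, g)\<close> gives the cocone \<open>u \<circ> \<sigma>\<close>, so the induced map agrees with \<open>u \<circ> \<epsilon>\<close>.
  This avoids knowing that the chosen colimit is computed pointwise.\<close>

lemma kappa_surj:
  assumes u\<phi>: "(u, \<phi>) \<in> one_step J C U f g" and g: "g \<in> Arr C"
  shows "\<exists>h\<in>hom C2 T g. kappa h = (u, \<phi>)"
proof -
  let ?i = "Id C (Dom C g)"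
  have gh: "g \<in> hom C (Dom C g) (Cod C g)"
    using g by (rule C.Arr_hom)
  have u: "u \<in> hom C2 f g" and ext: "\<phi> \<in> extensional (lifting_dom J C U f)"
    and \<phi>: "\<And>j \<sigma>. \<lbrakk>j \<in> Obj J; \<sigma> \<in> hom C2 (fobj U j) f\<rbrakk> \<Longrightarrow>
       \<phi> (j, \<sigma>) \<in> hom C (Cod C (fobj U j)) (Dom C g) \<and>
       \<phi> (j, \<sigma>) \<cdot>\<^bsub>C\<^esub> fobj U j = sq0 u \<cdot>\<^bsub>C\<^esub> sq0 \<sigma> \<and>
       g \<cdot>\<^bsub>C\<^esub> \<phi> (j, \<sigma>) = sq1 u \<cdot>\<^bsub>C\<^esub> sq1 \<sigma>"
    and \<phi>_nat: "\<And>i j \<alpha> \<sigma>. \<lbrakk>i \<in> Obj J; j \<in> Obj J; \<alpha> \<in> hom J i j; \<sigma> \<in> hom C2 (fobj U j) f\<rbrakk> \<Longrightarrow>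
       \<phi> (i, \<sigma> \<cdot>\<^bsub>C2\<^esub> farr U \<alpha>) = \<phi> (j, \<sigma>) \<cdot>\<^bsub>C\<^esub> sq1 (farr U \<alpha>)"
    using u\<phi> by (simp_all add: one_step_def del: arrow_cat_simps(5))
  note uD = arrow_homD[OF u]
  have ih: "?i \<in> hom C (Dom C g) (Dom C g)"
    using C.Dom_in_Obj[OF g] by (rule C.Id_in_hom)
  note iD = homD[OF ih]
  define \<psi> where "\<psi> x = Square (fobj U (fst x)) ?i (sq0 u \<cdot>\<^bsub>C\<^esub> sq0 (snd x)) (\<phi> x)" for x
  have \<psi>: "\<psi> (j, \<sigma>) \<in> hom C2 (fobj U j) ?i" if j: "j \<in> Obj J" "\<sigma> \<in> hom C2 (fobj U j) f" for j \<sigma>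
    using \<phi>[OF j] C.Comp_in_hom[OF arrow_homD(5)[OF j(2)] uD(5)] arrow_homD(1)[OF j(2)] iD
    by (simp add: \<psi>_def arrow_hom_iff C.Id_Comp)
  have "cocone (comma J C2 U f) C2 (comma_diagram U) ?i \<psi>"
    unfolding cocone_iff
  proof (intro conjI ballI)
    show "?i \<in> Arr C"
      by (rule iD)
    show "\<psi> (j, \<sigma>) \<cdot>\<^bsub>C2\<^esub> farr U \<alpha> = \<psi> (i, \<sigma> \<cdot>\<^bsub>C2\<^esub> farr U \<alpha>)"
      if ij: "i \<in> Obj J" "j \<in> Obj J" "\<alpha> \<in> hom J i j" "\<sigma> \<in> hom C2 (fobj U j) f" for i j \<alpha> \<sigma>
      using \<phi>_nat[OF ij] arrow_homD(3,5)[OF U.farr_in_hom[OF ij(3)]]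
        C.Comp_assoc[OF arrow_homD(5)[OF U.farr_in_hom[OF ij(3)]] arrow_homD(5)[OF ij(4)] uD(5)]
      by (simp add: \<psi>_def)
  qed (rule \<psi>)
  then obtain k where k: "k \<in> hom C2 Cf ?i"
    and k\<iota>: "\<And>x. x \<in> Obj (comma J C2 U f) \<Longrightarrow> k \<cdot>\<^bsub>C2\<^esub> \<iota> x = \<psi> x"
    using is_colimit_desc[OF colimit] by blast
  \<comment> \<open>The target of \<open>k\<close> is an identity, so commutativity makes its domain
    part redundant: \<open>k\<close> amounts to the map \<open>sq1 k\<close> out of the codomain of
    \<open>Cf\<close>.\<close>
  have kD: "sq0 k \<in> hom C (Dom C Cf) (Dom C g)" "sq1 k \<in> hom C (Cod C Cf) (Dom C g)"
    "sq0 k = sq1 k \<cdot>\<^bsub>C\<^esub> Cf"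
    using arrow_homD[OF k] iD by (simp_all add: C.Id_Comp)
  have k1\<iota>1: "sq1 k \<cdot>\<^bsub>C\<^esub> sq1 (\<iota> (j, \<sigma>)) = \<phi> (j, \<sigma>)" 
    if "j \<in> Obj J" "\<sigma> \<in> hom C2 (fobj U j) f" for j \<sigma>
    using k\<iota>[of "(j, \<sigma>)"] that by (simp add: \<psi>_def)
  have gi: "Square ?i g ?i g \<in> hom C2 ?i g"
    using iD g gh ih by (simp add: arrow_hom_iff)
  have "Square ?i g ?i g \<cdot>\<^bsub>C2\<^esub> k = u \<cdot>\<^bsub>C2\<^esub> \<epsilon>"
  proof (rule U.B.is_colimit_joint_epi[OF U.is_functor_comma_diagram colimit
        U.B.Comp_in_hom[OF k gi] U.B.Comp_in_hom[OF \<epsilon>_hom u]])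
    fix x
    assume x: "x \<in> Obj (comma J C2 U f)"
    then obtain j \<sigma> where x_eq: "x = (j, \<sigma>)" and j: "j \<in> Obj J" "\<sigma> \<in> hom C2 (fobj U j) f"
      by auto
    have "Square ?i g ?i g \<cdot>\<^bsub>C2\<^esub> k \<cdot>\<^bsub>C2\<^esub> \<iota> x = Square ?i g ?i g \<cdot>\<^bsub>C2\<^esub> \<psi> x"
      using U.B.Comp_assoc[OF \<iota>_hom[OF j] k gi] k\<iota>[OF x] by (simp only: x_eq)
    also have "\<dots> = u \<cdot>\<^bsub>C2\<^esub> \<sigma>"
      using \<phi>[OF j] C.Id_Comp[OF C.Comp_in_hom[OF arrow_homD(5)[OF j(2)] uD(5)]] uD arrow_homD[OF j(2)]
      by (simp add: \<psi>_def x_eq)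
    also have "\<dots> = u \<cdot>\<^bsub>C2\<^esub> \<epsilon> \<cdot>\<^bsub>C2\<^esub> \<iota> x"
      using U.B.Comp_assoc[OF \<iota>_hom[OF j] \<epsilon>_hom u] \<epsilon>_\<iota>[OF j] by (simp only: x_eq)
    finally show "Square ?i g ?i g \<cdot>\<^bsub>C2\<^esub> k \<cdot>\<^bsub>C2\<^esub> \<iota> x = u \<cdot>\<^bsub>C2\<^esub> \<epsilon> \<cdot>\<^bsub>C2\<^esub> \<iota> x" .
  qed
  \<comment> \<open>The domain part lets \<open>sq0 u\<close> and \<open>sq1 k\<close> be glued
    along the pushout; the codomain part will show, on \<open>q\<close>, that the glued map lies
    over \<open>sq1 u\<close>.\<close>
  then have u\<epsilon>: "sq0 u \<cdot>\<^bsub>C\<^esub> sq0 \<epsilon> = sq1 k \<cdot>\<^bsub>C\<^esub> Cf" "g \<cdot>\<^bsub>C\<^esub> sq1 k = sq1 u \<cdot>\<^bsub>C\<^esub> sq1 \<epsilon>"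
    using C.Id_Comp[OF kD(1)] kD(3) by (simp_all add: uD(4))
  obtain t where t: "t \<in> hom C S (Dom C g)" "t \<cdot>\<^bsub>C\<^esub> K = sq0 u" "t \<cdot>\<^bsub>C\<^esub> q = sq1 k"
    using pushout_desc[OF uD(5) kD(2) u\<epsilon>(1)] by blast
  have "g \<cdot>\<^bsub>C\<^esub> t = sq1 u \<cdot>\<^bsub>C\<^esub> T"
  proof (rule pushout_joint_epi)
    show "g \<cdot>\<^bsub>C\<^esub> t \<in> hom C S (Cod C g)" "sq1 u \<cdot>\<^bsub>C\<^esub> T \<in> hom C S (Cod C g)"
      using C.Comp_in_hom t(1) gh T_hom uD(6) by blast+
    show "g \<cdot>\<^bsub>C\<^esub> t \<cdot>\<^bsub>C\<^esub> K = sq1 u \<cdot>\<^bsub>C\<^esub> T \<cdot>\<^bsub>C\<^esub> K"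
      using C.Comp_assoc[OF K_hom t(1) gh] C.Comp_assoc[OF K_hom T_hom uD(6)] t T_K uD(7) by simp
    show "g \<cdot>\<^bsub>C\<^esub> t \<cdot>\<^bsub>C\<^esub> q = sq1 u \<cdot>\<^bsub>C\<^esub> T \<cdot>\<^bsub>C\<^esub> q"
      using C.Comp_assoc[OF q_hom t(1) gh] C.Comp_assoc[OF q_hom T_hom uD(6)] t T_q u\<epsilon>(2) by simp
  qed
  then have "Square T g t (sq1 u) \<in> hom C2 T g"
    using homD[OF T_hom] t(1) uD g by (simp add: arrow_hom_iff)
  \<comment> \<open>Off \<open>lifting_dom\<close> both sides are \<open>undefined\<close>; this is
    what extensionality of \<open>\<phi>\<close> is for.\<close>
  moreover have "restrict (\<lambda>x. sq1 k \<cdot>\<^bsub>C\<^esub> sq1 (\<iota> x)) (lifting_dom J C U f) = \<phi>"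
    using ext k1\<iota>1 by (auto intro!: extensionalityI[OF restrict_extensional] simp: lifting_dom_def)
  then have "kappa (Square T g t (sq1 u)) = (u, \<phi>)"
    using t uD by (simp add: kappa_def square.expand)
  ultimately show ?thesis
    by blast
qed

lemma bij_betw_kappa:
  assumes "g \<in> Arr C"
  shows "bij_betw kappa (hom C2 T g) (one_step J C U f g)"
  unfolding bij_betw_def
proof
  show "inj_on kappa (hom C2 T g)"
    using kappa_inj by (blast intro: inj_onI)
  show "kappa ` hom C2 T g = one_step J C U f g"
    using kappa_in_one_step kappa_surj[OF _ assms] by (auto simp: image_iff) metis
qed

text \<open>Naturality is associativity: \<open>b\<close> acts on the left of \<open>sq0 h\<close>,
  while \<open>K\<close>, \<open>q\<close> and the coprojections act on its right.\<close>

lemma kappa_natural: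
  assumes b: "b \<in> hom C2 g g'" and h: "h \<in> hom C2 T g"
  shows "kappa (b \<cdot>\<^bsub>C2\<^esub> h) = one_step_map J C U f b (kappa h)"
proof -
  note hD = T_square_homD[OF h] and bD = arrow_homD[OF b]
  have "restrict (\<lambda>x. sq0 b \<cdot>\<^bsub>C\<^esub> sq0 h \<cdot>\<^bsub>C\<^esub> q \<cdot>\<^bsub>C\<^esub> sq1 (\<iota> x)) (lifting_dom J C U f) =
    restrict (\<lambda>x. sq0 b \<cdot>\<^bsub>C\<^esub> (sq0 h \<cdot>\<^bsub>C\<^esub> q \<cdot>\<^bsub>C\<^esub> sq1 (\<iota> x))) (lifting_dom J C U f)"
  proof (rule restrict_ext)
    fix x
    assume "x \<in> lifting_dom J C U f"
    then obtain j \<sigma> where x: "x = (j, \<sigma>)" "j \<in> Obj J" "\<sigma> \<in> hom C2 (fobj U j) f"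
      by (auto simp: lifting_dom_def)
    show "sq0 b \<cdot>\<^bsub>C\<^esub> sq0 h \<cdot>\<^bsub>C\<^esub> q \<cdot>\<^bsub>C\<^esub> sq1 (\<iota> x) = sq0 b \<cdot>\<^bsub>C\<^esub> (sq0 h \<cdot>\<^bsub>C\<^esub> q \<cdot>\<^bsub>C\<^esub> sq1 (\<iota> x))"
      using C.Comp_assoc[OF q_hom hD(4) bD(5)]
        C.Comp_assoc[OF \<iota>D(6)[OF x(2,3)] C.Comp_in_hom[OF q_hom hD(4)] bD(5)] by (simp add: x)
  qed
  \<comment> \<open>The inner restriction is invisible, since the outer one evaluates it only on
    \<open>X\<close>.\<close>
  moreover have "restrict (\<lambda>x. sq0 b \<cdot>\<^bsub>C\<^esub> restrict \<theta> X x) X = restrict (\<lambda>x. sq0 b \<cdot>\<^bsub>C\<^esub> \<theta> x) X" for \<theta> and X :: "('j \<times> 'm square) set"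
    by (rule restrict_ext) simp
  ultimately show ?thesis
    using hD(3) bD(4) C.Comp_assoc[OF K_hom hD(4) bD(5)]
    by (simp add: kappa_def one_step_map_def)
qed

end

theorem theorem8:
  fixes \<Omega> :: "'u rel"
    and C :: "('o, 'm) cat"
    and J :: "('j, 'a) cat"
    and U :: "('j, 'a, 'm, 'm square) ftor"
    and f :: 'm
  assumes "size_cardinal \<Omega>"
    and "category C"
    and "locally_small \<Omega> C"
    and "cocomplete \<Omega> C"
    and "category J"
    and "small_cat \<Omega> J"
    and "is_functor J (arrow_cat C) U"
    and "f \<in> Obj (arrow_cat C)"
  shows "\<exists>\<kappa> :: 'm \<Rightarrow> 'm square \<Rightarrow> 'm square \<times> ('j \<times> 'm square \<Rightarrow> 'm).
    (\<forall>g\<in>Obj (arrow_cat C).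
       bij_betw (\<kappa> g) (hom (arrow_cat C) (T_of J C U f) g) (one_step J C U f g)) \<and>
    (\<forall>g\<in>Obj (arrow_cat C). \<forall>g'\<in>Obj (arrow_cat C). \<forall>b\<in>hom (arrow_cat C) g g'.
       \<forall>h\<in>hom (arrow_cat C) (T_of J C U f) g.
         \<kappa> g' (b \<cdot>\<^bsub>arrow_cat C\<^esub> h) = one_step_map J C U f b (\<kappa> g h))"
proof -
  interpret C: category C
    by fact
  interpret U: is_functor J "arrow_cat C" U
    by fact
  have f: "f \<in> Arr C"
    using assms(8) by simp
  have small: "small_cat \<Omega> (comma J (arrow_cat C) U f)"
    using U.small_cat_comma[OF assms(1,6)] small_arrow_hom[OF assms(1-3) _ f] U.fobj_in_Obj by simp
  \<comment> \<open>\<open>refl\<close> fixes the two component diagrams of the comma diagram; both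
    take values in \<open>C\<close>, where cocompleteness applies.\<close>
  note AC = C.arrow_cat_colimit[OF U.is_functor_comma_diagram refl refl]
  interpret one_step_setting C J U f
  proof
    show "f \<in> Arr C"
      by (rule f)
    show "\<exists>c \<iota>. is_colimit (comma J (arrow_cat C) U f) (arrow_cat C) (comma_diagram U) c \<iota>"
      using cocomplete_colimit[OF assms(1,4) small AC(1)] cocomplete_colimit[OF assms(1,4) small AC(2)] AC(3)
      by blast
    show "\<exists>p q. is_pushout C h k p q" if "h \<in> hom C a b" "k \<in> hom C a c" for h k a b c
      using C.cocomplete_pushout[OF assms(1,4) that] .
  qed
  show ?thesis
    using bij_betw_kappa kappa_natural by (intro exI[of _ "\<lambda>_. kappa"]) (simp del: arrow_cat_simps(5))
qed

end
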